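(* Let $2\leq k\leq d$ be integers and let $\Phi:\mathbb{M}_d\to\mathbb{M}_d$ be a $k$-entanglement breaking CP-map. Then $\Phi^m$ (the $m$-fold composition of $\Phi$ with itself) is entanglement breaking, where $m=\min\left\{SN(\Phi),\left\lceil\frac{d-1}{k-1}\right\rceil\right\}$.
   Context: $\mathbb{M}_d$ is the algebra of complex $d\times d$ matrices; a superscript $+$ denotes the cone of positive semidefinite matrices. A linear map is positive if it preserves positive semidefiniteness, $k$-positive if its tensor product with the identity map $\mathrm{id}_k$ of $\mathbb{M}_k$ is positive, and completely positive (CP) if it is $k$-positive for all $k\ge1$. $X\in(\mathbb{M}_{m}\otimes\mathbb{M}_{n})^+$ is separable if $X=\sum_i A_i\otimes B_i$ (finite sum) with $A_i\in\mathbb{M}_m^+$, $B_i\in\mathbb{M}_n^+$. A linear map $\Phi:\mathbb{M}_{d}\to\mathbb{M}_{d}$ is entanglement breaking if $(\mathrm{id}_n\otimes\Phi)(X)$ is separable for all $n\ge1$, $X\in(\mathbb{M}_n\otimes\mathbb{M}_{d})^+$, and $k$-entanglement breaking if it is $k$-positive and $(\mathrm{id}_k\otimes\Phi)(X)$ is separable for every $X\in(\mathbb{M}_k\otimes\mathbb{M}_{d})^+$. The Schmidt rank $SR(\xi)$ of $\xi\in\mathbb{C}^{m}\otimes\mathbb{C}^{n}$ is the number of nonzero coefficients in a Schmidt decomposition $\xi=\sum_i\lambda_i\,u_i\otimes v_i$ ($\{u_i\}$, $\{v_i\}$ orthonormal, $\lambda_i\ge0$). The Schmidt number of $X\in(\mathbb{M}_m\otimes\mathbb{M}_n)^+$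 is $SN(X)=\min\max_i SR(\xi_i)$, the minimum being over all finite decompositions $X=\sum_i|\xi_i\rangle\langle\xi_i|$, where $|\xi\rangle\langle\xi|(z)=\xi\langle\xi,z\rangle$; $X$ is separable if and only if $SN(X)=1$ (in particular the zero matrix is counted as having Schmidt number $1$). For a CP-map $\Phi$, $SN(\Phi):=SN(C_\Phi)$, where $C_\Phi=\sum_{i,j}E_{ij}\otimes\Phi(E_{ij})$ is the Choi matrix. *)

theory Defs
  imports "Jordan_Normal_Form.VS_Connect" "Jordan_Normal_Form.Conjugate"
begin

text \<open>
  Elements of \<open>M\<^sub>d\<close> are \<^typ>\<open>complex mat\<close> in \<open>carrier_mat d d\<close>. The spaces \<open>C\<^sup>m \<otimes> C\<^sup>n\<close> and
  \<open>M\<^sub>m \<otimes> M\<^sub>n\<close> are identified with \<open>carrier_vec (m * n)\<close> and \<open>carrier_mat (m * n) (m * n)\<close>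
  through the Kronecker product: the index pair \<open>(i, a)\<close> with \<open>i < m\<close>, \<open>a < n\<close> becomes
  \<open>i * n + a\<close>.
\<close>

definition kron_vec :: "complex vec \<Rightarrow> complex vec \<Rightarrow> complex vec" where
  "kron_vec u v =
     vec (dim_vec u * dim_vec v) (\<lambda>i. u $ (i div dim_vec v) * v $ (i mod dim_vec v))"

definition kron :: "complex mat \<Rightarrow> complex mat \<Rightarrow> complex mat" where
  "kron A B =
     mat (dim_row A * dim_row B) (dim_col A * dim_col B)
       (\<lambda>(i, j). A $$ (i div dim_row B, j div dim_col B) * B $$ (i mod dim_row B, j mod dim_col B))"

abbreviation mat_finsum :: "nat \<Rightarrow> ('i \<Rightarrow> complex mat) \<Rightarrow> 'i set \<Rightarrow> complex mat" where
  "mat_finsum n \<equiv> finsum (module_mat TYPE(complex) n n)"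

definition mat_unit :: "nat \<Rightarrow> nat \<Rightarrow> nat \<Rightarrow> complex mat" where
  "mat_unit n i j = mat n n (\<lambda>(a, b). if a = i \<and> b = j then 1 else 0)"

definition ketbra :: "complex vec \<Rightarrow> complex mat" where
  "ketbra \<xi> = mat (dim_vec \<xi>) (dim_vec \<xi>) (\<lambda>(a, b). \<xi> $ a * conjugate (\<xi> $ b))"

text \<open>
  The order on \<^typ>\<open>complex\<close> is the one where \<open>0 \<le> z\<close> means that \<open>z\<close> is real and nonnegative,
  so that the condition below forces \<open>A\<close> to be Hermitian.
\<close>

definition psd :: "nat \<Rightarrow> complex mat \<Rightarrow> bool" where
  "psd n A \<longleftrightarrow> A \<in> carrier_mat n n \<and> (\<forall>v \<in> carrier_vec n. 0 \<le> (A *\<^sub>v v) \<bullet>c v)"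

definition separable :: "nat \<Rightarrow> nat \<Rightarrow> complex mat \<Rightarrow> bool" where
  "separable m n X \<longleftrightarrow> psd (m * n) X \<and>
     (\<exists>(r::nat) A B. (\<forall>i<r. psd m (A i) \<and> psd n (B i)) \<and>
        X = mat_finsum (m * n) (\<lambda>i. kron (A i) (B i)) {..<r})"

abbreviation mat_linear :: "nat \<Rightarrow> (complex mat \<Rightarrow> complex mat) \<Rightarrow> bool" where
  "mat_linear d \<equiv>
     linear_map class_ring (module_mat TYPE(complex) d d) (module_mat TYPE(complex) d d)"

definition mat_block :: "nat \<Rightarrow> nat \<Rightarrow> nat \<Rightarrow> complex mat \<Rightarrow> complex mat" where
  "mat_block d i j X = mat d d (\<lambda>(a, b). X $$ (i * d + a, j * d + b))"

text \<open>
  \<open>id_tensor n d \<Phi>\<close> is \<open>id\<^sub>n \<otimes> \<Phi>\<close>: every \<open>X\<close> in \<open>M\<^sub>n \<otimes> M\<^sub>d\<close> equals the sum of the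
  \<open>E\<^sub>i\<^sub>j \<otimes> X\<^sub>i\<^sub>j\<close> over its blocks \<open>X\<^sub>i\<^sub>j\<close> in \<open>M\<^sub>d\<close>, and \<open>id\<^sub>n \<otimes> \<Phi>\<close> sends it to the sum of the
  \<open>E\<^sub>i\<^sub>j \<otimes> \<Phi>(X\<^sub>i\<^sub>j)\<close>. Lemma \<open>id_tensor_kron\<close> below gives the action on elementary tensors.
\<close>

definition id_tensor ::
  "nat \<Rightarrow> nat \<Rightarrow> (complex mat \<Rightarrow> complex mat) \<Rightarrow> complex mat \<Rightarrow> complex mat" where
  "id_tensor n d \<Phi> X =
     mat_finsum (n * d) (\<lambda>(i, j). kron (mat_unit n i j) (\<Phi> (mat_block d i j X)))
       ({..<n} \<times> {..<n})"

definition positive_map :: "nat \<Rightarrow> (complex mat \<Rightarrow> complex mat) \<Rightarrow> bool" where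
  "positive_map d \<Phi> \<longleftrightarrow> mat_linear d \<Phi> \<and> (\<forall>X. psd d X \<longrightarrow> psd d (\<Phi> X))"

definition k_positive :: "nat \<Rightarrow> nat \<Rightarrow> (complex mat \<Rightarrow> complex mat) \<Rightarrow> bool" where
  "k_positive k d \<Phi> \<longleftrightarrow> mat_linear d \<Phi> \<and> positive_map (k * d) (id_tensor k d \<Phi>)"

definition completely_positive :: "nat \<Rightarrow> (complex mat \<Rightarrow> complex mat) \<Rightarrow> bool" where
  "completely_positive d \<Phi> \<longleftrightarrow> (\<forall>k\<ge>1. k_positive k d \<Phi>)"

definition entanglement_breaking :: "nat \<Rightarrow> (complex mat \<Rightarrow> complex mat) \<Rightarrow> bool" where
  "entanglement_breaking d \<Phi> \<longleftrightarrow> mat_linear d \<Phi> \<and>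
     (\<forall>n\<ge>1. \<forall>X. psd (n * d) X \<longrightarrow> separable n d (id_tensor n d \<Phi> X))"

definition k_entanglement_breaking ::
  "nat \<Rightarrow> nat \<Rightarrow> (complex mat \<Rightarrow> complex mat) \<Rightarrow> bool" where
  "k_entanglement_breaking k d \<Phi> \<longleftrightarrow> k_positive k d \<Phi> \<and>
     (\<forall>X. psd (k * d) X \<longrightarrow> separable k d (id_tensor k d \<Phi> X))"

definition orthonormal_family :: "nat \<Rightarrow> nat \<Rightarrow> (nat \<Rightarrow> complex vec) \<Rightarrow> bool" where
  "orthonormal_family n r u \<longleftrightarrow>
     (\<forall>i<r. u i \<in> carrier_vec n) \<and> (\<forall>i<r. \<forall>j<r. u i \<bullet>c u j = (if i = j then 1 else 0))"

definition schmidt_decomposition ::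
  "nat \<Rightarrow> nat \<Rightarrow> complex vec \<Rightarrow> nat \<Rightarrow> (nat \<Rightarrow> real) \<Rightarrow> (nat \<Rightarrow> complex vec) \<Rightarrow> (nat \<Rightarrow> complex vec)
    \<Rightarrow> bool" where
  "schmidt_decomposition m n \<xi> r c u v \<longleftrightarrow>
     orthonormal_family m r u \<and> orthonormal_family n r v \<and> (\<forall>i<r. 0 \<le> c i) \<and>
     \<xi> = finsum_vec TYPE(complex) (m * n) (\<lambda>i. complex_of_real (c i) \<cdot>\<^sub>v kron_vec (u i) (v i)) {..<r}"

text \<open>The number of nonzero coefficients is the same for all Schmidt decompositions of \<open>\<xi>\<close>.\<close>

definition schmidt_rank :: "nat \<Rightarrow> nat \<Rightarrow> complex vec \<Rightarrow> nat" where
  "schmidt_rank m n \<xi> =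
     (THE s. \<exists>r c u v. schmidt_decomposition m n \<xi> r c u v \<and> s = card {i. i < r \<and> c i \<noteq> 0})"

text \<open>
  The extra element 1 in the maximum only matters for \<open>X = 0\<close>, whose decompositions are empty or
  consist of zero vectors (of Schmidt rank 0); by convention \<open>0\<close> has Schmidt number 1.
\<close>

definition schmidt_number :: "nat \<Rightarrow> nat \<Rightarrow> complex mat \<Rightarrow> nat" where
  "schmidt_number m n X =
     (LEAST s. \<exists>(r::nat) \<xi>. (\<forall>i<r. \<xi> i \<in> carrier_vec (m * n)) \<and>
        X = mat_finsum (m * n) (\<lambda>i. ketbra (\<xi> i)) {..<r} \<and>
        s = Max (insert 1 ((\<lambda>i. schmidt_rank m n (\<xi> i)) ` {..<r})))"

definition choi :: "nat \<Rightarrow> (complex mat \<Rightarrow> complex mat) \<Rightarrow> complex mat" where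
  "choi d \<Phi> =
     mat_finsum (d * d) (\<lambda>(i, j). kron (mat_unit d i j) (\<Phi> (mat_unit d i j))) ({..<d} \<times> {..<d})"

definition map_schmidt_number :: "nat \<Rightarrow> (complex mat \<Rightarrow> complex mat) \<Rightarrow> nat" where
  "map_schmidt_number d \<Phi> = schmidt_number d d (choi d \<Phi>)"

lemma mat_finsum_carrier:
  assumes "finite I" "\<And>i. i \<in> I \<Longrightarrow> f i \<in> carrier_mat n n"
  shows "mat_finsum n f I \<in> carrier_mat n n"
proof -
  interpret M: abelian_group "module_mat TYPE(complex) n n" by (rule abelian_group_mat)
  show ?thesis
    using M.finsum_closed[of f I] assms by (auto simp: module_mat_simps)
qed

lemma mat_finsum_index:
  assumes "finite I" "\<And>i. i \<in> I \<Longrightarrow> f i \<in> carrier_mat n n" "a < n" "b < n"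
  shows "mat_finsum n f I $$ (a, b) = (\<Sum>i\<in>I. f i $$ (a, b))"
proof -
  interpret M: abelian_group "module_mat TYPE(complex) n n" by (rule abelian_group_mat)
  show ?thesis using assms(1,2)
  proof (induction I rule: finite_induct)
    case empty
    then show ?case using assms(3,4) by (simp add: module_mat_simps)
  next
    case (insert x F)
    have "mat_finsum n f (insert x F) = f x + mat_finsum n f F"
      using M.finsum_insert[of F x f] insert by (auto simp: module_mat_simps)
    moreover have "mat_finsum n f F \<in> carrier_mat n n"
      using insert by (intro mat_finsum_carrier) auto
    ultimately show ?case using insert assms(3,4) by auto
  qed
qed

lemma id_tensor_index:
  assumes "mat_linear d \<Phi>" "a < n * d" "b < n * d"
  shows "id_tensor n d \<Phi> X $$ (a, b) =
           \<Phi> (mat_block d (a div d) (b div d) X) $$ (a mod d, b mod d)"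
proof -
  interpret L: linear_map class_ring "module_mat TYPE(complex) d d"
    "module_mat TYPE(complex) d d" \<Phi> by (rule assms)
  have d: "d > 0" using assms by (cases d) auto
  have car: "\<Phi> (mat_block d i j X) \<in> carrier_mat d d" for i j
    using L.f_hom by (auto simp: LinearCombinations.module_hom_def module_mat_simps mat_block_def Pi_def)
  have kc: "kron (mat_unit n i j) (\<Phi> (mat_block d i j X)) \<in> carrier_mat (n * d) (n * d)" for i j
    using car[of i j] by (auto simp: kron_def mat_unit_def)
  have lt: "a div d < n" "b div d < n"
    using assms by (auto simp: less_mult_imp_div_less)
  have "id_tensor n d \<Phi> X $$ (a, b) =
     (\<Sum>p\<in>{..<n} \<times> {..<n}. (case p of (i, j) \<Rightarrow> kron (mat_unit n i j) (\<Phi> (mat_block d i j X))) $$ (a, b))"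
    unfolding id_tensor_def using kc assms by (intro mat_finsum_index) auto
  also have "\<dots> = (\<Sum>p\<in>{..<n} \<times> {..<n}. if p = (a div d, b div d)
      then \<Phi> (mat_block d (a div d) (b div d) X) $$ (a mod d, b mod d) else 0)"
  proof (rule sum.cong[OF refl])
    fix p assume "p \<in> {..<n} \<times> {..<n}"
    obtain i j where p: "p = (i, j)" by force
    show "(case p of (i, j) \<Rightarrow> kron (mat_unit n i j) (\<Phi> (mat_block d i j X))) $$ (a, b) =
      (if p = (a div d, b div d)
       then \<Phi> (mat_block d (a div d) (b div d) X) $$ (a mod d, b mod d) else 0)"
      using car[of i j] assms lt by (auto simp: p kron_def mat_unit_def)
  qed
  also have "\<dots> = \<Phi> (mat_block d (a div d) (b div d) X) $$ (a mod d, b mod d)"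
    using lt by simp
  finally show ?thesis .
qed

lemma id_tensor_kron:
  assumes lin: "mat_linear d \<Phi>" and A: "A \<in> carrier_mat n n" and B: "B \<in> carrier_mat d d"
  shows "id_tensor n d \<Phi> (kron A B) = kron A (\<Phi> B)"
proof -
  interpret L: linear_map class_ring "module_mat TYPE(complex) d d"
    "module_mat TYPE(complex) d d" \<Phi> by (rule lin)
  have hom: "\<Phi> C \<in> carrier_mat d d" "\<Phi> (c \<cdot>\<^sub>m C) = c \<cdot>\<^sub>m \<Phi> C" if "C \<in> carrier_mat d d" for C c
    using L.f_hom that by (simp_all add: LinearCombinations.module_hom_def module_mat_simps Pi_def)
  have blk: "mat_block d i j (kron A B) = A $$ (i, j) \<cdot>\<^sub>m B" if "i < n" "j < n" for i j
  proof -
    have "i * d + x < n * d" if "i < n" "x < d" for i x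
    proof -
      have "i * d + x < Suc i * d" using that by simp
      also have "\<dots> \<le> n * d" using that by (intro mult_le_mono1) auto
      finally show ?thesis .
    qed
    then show ?thesis using that A B
      by (intro eq_matI) (auto simp: mat_block_def kron_def)
  qed
  have "id_tensor n d \<Phi> (kron A B) \<in> carrier_mat (n * d) (n * d)"
    unfolding id_tensor_def
    by (intro mat_finsum_carrier)
       (auto simp: kron_def mat_unit_def mat_block_def carrier_matD[OF hom(1)])
  note car = this
  have kc: "kron A (\<Phi> B) \<in> carrier_mat (n * d) (n * d)"
    using A hom(1)[OF B] by (auto simp: kron_def)
  show ?thesis
  proof (rule eq_matI)
    fix a b assume "a < dim_row (kron A (\<Phi> B))" "b < dim_col (kron A (\<Phi> B))"
    then have ab: "a < n * d" "b < n * d" using kc by auto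
    then have lt: "a div d < n" "b div d < n" "a mod d < d" "b mod d < d"
      by (auto simp: less_mult_imp_div_less intro!: mod_less_divisor gr0I)
    have "id_tensor n d \<Phi> (kron A B) $$ (a, b)
        = \<Phi> (A $$ (a div d, b div d) \<cdot>\<^sub>m B) $$ (a mod d, b mod d)"
      by (simp add: id_tensor_index[OF lin ab] blk lt)
    also have "\<dots> = A $$ (a div d, b div d) * \<Phi> B $$ (a mod d, b mod d)"
      using hom(1)[OF B] lt by (simp add: hom(2)[OF B])
    also have "\<dots> = kron A (\<Phi> B) $$ (a, b)"
      using A hom(1)[OF B] ab by (simp add: kron_def)
    finally show "id_tensor n d \<Phi> (kron A B) $$ (a, b) = kron A (\<Phi> B) $$ (a, b)" .
  qed (use car kc in auto)
qed

end

theory Submission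
  imports Defs "Jordan_Normal_Form.Spectral_Radius"
begin

text \<open>
  Suppose that a vector \<open>\<xi> = \<Sum>\<^sub>j\<^sub><\<^sub>s \<alpha>\<^sub>j \<otimes> \<beta>\<^sub>j\<close> has Schmidt rank at most \<open>s\<close>, where \<open>s \<ge> k\<close>. A single
  application of \<open>id \<otimes> \<Phi>\<close> to \<open>|\<xi>\<rangle>\<langle>\<xi>|\<close> produces a matrix of Schmidt number at most \<open>s - k + 1\<close>.
  Indeed, up to the map \<open>e\<^sub>j \<mapsto> \<alpha>\<^sub>j\<close> on the first factor, which keeps product vectors product vectors,
  the result is \<open>W = (id\<^sub>s \<otimes> \<Phi>)(|\<eta>\<rangle>\<langle>\<eta>|)\<close> with \<open>\<eta> = \<Sum>\<^sub>j e\<^sub>j \<otimes> \<beta>\<^sub>j\<close>. Its leading \<open>k \<times> k\<close> block is the image of a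
  positive matrix under \<open>id\<^sub>k \<otimes> \<Phi>\<close>, hence a sum of terms \<open>|p\<rangle>\<langle>p|\<close> with product vectors \<open>p\<close>, because
  \<open>\<Phi>\<close> is \<open>k\<close>-entanglement breaking. A positive matrix whose leading block is \<open>\<Sum>|p\<rangle>\<langle>p|\<close> is itself
  \<open>\<Sum>|q\<rangle>\<langle>q| + \<Sum>|h\<rangle>\<langle>h|\<close>, where every \<open>q\<close> prolongs one of the \<open>p\<close> and every \<open>h\<close> vanishes on the block
  (\<open>block_extension\<close>, a Schur complement argument). The remaining \<open>s - k\<close> rows add at most \<open>s - k\<close> to
  the Schmidt rank, which gives the bound (\<open>sn_le_block_extension\<close>, \<open>sn_le_choi_apply_decrease\<close>).

  A matrix in \<open>M\<^sub>n \<otimes> M\<^sub>d\<close> has Schmidt number at most \<open>d\<close>, and every application of \<open>\<Phi>\<close> lowers the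
  bound by \<open>k - 1\<close> until it reaches 1, that is, separability; so \<open>\<lceil>(d - 1) / (k - 1)\<rceil>\<close> applications
  suffice. Alternatively, the first application already brings the Schmidt number down to
  \<open>SN(\<Phi>)\<close>, since the vectors in a decomposition of the Choi matrix are the Kraus operators of \<open>\<Phi>\<close>
  (\<open>sn_le_choi_apply\<close>), and every later application lowers the bound by at least 1; so \<open>SN(\<Phi>)\<close>
  applications suffice as well.

  All linear algebra is done with index functions of type \<open>nat \<Rightarrow> complex\<close> restricted to initial
  segments, and matrices in \<open>M\<^sub>n \<otimes> M\<^sub>d\<close> are read as tensors with four indices. The Schmidt rank is
  defined through decompositions with orthonormal vectors; that it bounds the number of product
  terms needed rests on the existence of such decompositions, a consequence of the spectral
  theorem, and on the uniqueness of their number of nonzero coefficients, a consequence of Bessel's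
  inequality.
\<close>

section \<open>Orthonormal families\<close>

definition ip :: "nat \<Rightarrow> (nat \<Rightarrow> complex) \<Rightarrow> (nat \<Rightarrow> complex) \<Rightarrow> complex" where
  "ip n u v = (\<Sum>a<n. u a * cnj (v a))"

definition orthonormal :: "nat \<Rightarrow> nat \<Rightarrow> (nat \<Rightarrow> nat \<Rightarrow> complex) \<Rightarrow> bool" where
  "orthonormal n r u \<longleftrightarrow> (\<forall>i<r. \<forall>j<r. ip n (u i) (u j) = (if i = j then 1 else 0))"

definition matvec :: "nat \<Rightarrow> (nat \<Rightarrow> nat \<Rightarrow> complex) \<Rightarrow> (nat \<Rightarrow> complex) \<Rightarrow> nat \<Rightarrow> complex" where
  "matvec n H v = (\<lambda>a. \<Sum>b<n. H a b * v b)"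

lemma sum_times_delta:
  fixes f :: "nat \<Rightarrow> 'a :: semiring_1"
  assumes "b < n"
  shows "(\<Sum>a<n. f a * (if a = b then 1 else 0)) = f b"
    and "(\<Sum>a<n. f a * (if b = a then 1 else 0)) = f b"
proof -
  have "(\<Sum>a<n. f a * (if a = b then 1 else 0)) = (\<Sum>a<n. if a = b then f a else 0)"
    by (intro sum.cong) auto
  then show "(\<Sum>a<n. f a * (if a = b then 1 else 0)) = f b" using assms by simp
  then show "(\<Sum>a<n. f a * (if b = a then 1 else 0)) = f b" by (simp only: eq_commute[of b])
qed

lemma ip_cnj: "cnj (ip n u v) = ip n v u"
  by (simp add: ip_def mult.commute)

lemma ip_cong: "(\<And>a. a < n \<Longrightarrow> u a = u' a) \<Longrightarrow> (\<And>a. a < n \<Longrightarrow> v a = v' a) \<Longrightarrow> ip n u v = ip n u' v'"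
  by (simp add: ip_def)

lemma ip_add_left: "ip n (\<lambda>a. u a + v a) w = ip n u w + ip n v w"
  by (simp add: ip_def sum.distrib algebra_simps)

lemma ip_diff_left: "ip n (\<lambda>a. u a - v a) w = ip n u w - ip n v w"
  by (simp add: ip_def sum_subtractf algebra_simps)

lemma ip_scale_left: "ip n (\<lambda>a. c * u a) w = c * ip n u w"
  by (simp add: ip_def sum_distrib_left algebra_simps)

lemma ip_sum_left: "ip n (\<lambda>a. \<Sum>i\<in>I. f i a) w = (\<Sum>i\<in>I. ip n (f i) w)"
  unfolding ip_def sum_distrib_right by (rule sum.swap)

lemma ip_add_right: "ip n w (\<lambda>a. u a + v a) = ip n w u + ip n w v"
  by (simp add: ip_def sum.distrib algebra_simps)

lemma ip_diff_right: "ip n w (\<lambda>a. u a - v a) = ip n w u - ip n w v"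
  by (simp add: ip_def sum_subtractf algebra_simps)

lemma ip_scale_right: "ip n w (\<lambda>a. c * u a) = cnj c * ip n w u"
  by (simp add: ip_def sum_distrib_left algebra_simps)

lemma ip_sum_right: "ip n w (\<lambda>a. \<Sum>i\<in>I. f i a) = (\<Sum>i\<in>I. ip n w (f i))"
  unfolding ip_def cnj_sum sum_distrib_left by (rule sum.swap)

lemmas ip_linear = ip_add_left ip_diff_left ip_scale_left ip_sum_left
  ip_add_right ip_diff_right ip_scale_right ip_sum_right

lemma ip_self: "ip n u u = complex_of_real (\<Sum>a<n. (cmod (u a))\<^sup>2)"
  unfolding ip_def of_real_sum by (intro sum.cong refl) (simp only: complex_norm_square)

lemma ip_self_eq_0_iff: "ip n u u = 0 \<longleftrightarrow> (\<forall>a<n. u a = 0)"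
proof -
  have "ip n u u = 0 \<longleftrightarrow> (\<Sum>a<n. (cmod (u a))\<^sup>2) = 0"
    unfolding ip_self of_real_eq_0_iff ..
  also have "\<dots> \<longleftrightarrow> (\<forall>a<n. u a = 0)" by (subst sum_nonneg_eq_0_iff) auto
  finally show ?thesis .
qed

lemma orthonormalD:
  "orthonormal n r u \<Longrightarrow> i < r \<Longrightarrow> j < r \<Longrightarrow> ip n (u i) (u j) = (if i = j then 1 else 0)"
  by (simp add: orthonormal_def)

lemma ip_orthonormal_sum:
  assumes "orthonormal n r u" "j < r"
  shows "ip n (\<lambda>a. \<Sum>i<r. c i * u i a) (u j) = c j"
proof -
  have "ip n (\<lambda>a. \<Sum>i<r. c i * u i a) (u j) = (\<Sum>i<r. c i * (if i = j then 1 else 0))"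
    unfolding ip_sum_left ip_scale_left
    by (intro sum.cong refl) (simp add: orthonormalD[OF assms(1) _ assms(2)])
  also have "\<dots> = c j" using assms(2) by (simp add: sum_times_delta)
  finally show ?thesis .
qed

definition residual :: "nat \<Rightarrow> nat \<Rightarrow> (nat \<Rightarrow> nat \<Rightarrow> complex) \<Rightarrow> (nat \<Rightarrow> complex) \<Rightarrow> nat \<Rightarrow> complex" where
  "residual n r u x = (\<lambda>a. x a - (\<Sum>i<r. ip n x (u i) * u i a))"

lemma residual_orthogonal:
  assumes "orthonormal n r u" "j < r"
  shows "ip n (residual n r u x) (u j) = 0"
  unfolding residual_def ip_diff_left by (simp add: ip_orthonormal_sum[OF assms])

text \<open>
  Pythagoras: the residual is orthogonal to the family, so its squared norm is what the
  projection onto the family leaves over. Bessel's inequality, the extension of orthonormal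
  families and the completeness of a family of full size are all read off from this identity.
\<close>

lemma residual_norm:
  assumes "orthonormal n r u"
  shows "ip n (residual n r u x) (residual n r u x) = 
    complex_of_real ((\<Sum>a<n. (cmod (x a))\<^sup>2) - (\<Sum>i<r. (cmod (ip n x (u i)))\<^sup>2))"
proof -
  let ?R = "residual n r u x"
  have "ip n ?R ?R = ip n ?R x - (\<Sum>i<r. cnj (ip n x (u i)) * ip n ?R (u i))"
    by (subst (2) residual_def) (simp add: ip_linear)
  also have "(\<Sum>i<r. cnj (ip n x (u i)) * ip n ?R (u i)) = 0"
    by (intro sum.neutral) (simp add: residual_orthogonal[OF assms])
  also have "ip n ?R x = ip n x x - (\<Sum>i<r. ip n x (u i) * ip n (u i) x)"
    by (subst residual_def) (simp add: ip_linear)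
  also have "(\<Sum>i<r. ip n x (u i) * ip n (u i) x) = (\<Sum>i<r. complex_of_real ((cmod (ip n x (u i)))\<^sup>2))"
    by (intro sum.cong refl) (simp only: complex_norm_square ip_cnj)
  finally show ?thesis unfolding ip_self by simp
qed

lemma bessel:
  assumes "orthonormal n r u"
  shows "(\<Sum>i<r. (cmod (ip n x (u i)))\<^sup>2) \<le> (\<Sum>a<n. (cmod (x a))\<^sup>2)"
proof -
  have "(\<Sum>a<n. (cmod (residual n r u x a))\<^sup>2)
      = (\<Sum>a<n. (cmod (x a))\<^sup>2) - (\<Sum>i<r. (cmod (ip n x (u i)))\<^sup>2)"
    using residual_norm[OF assms, of x] unfolding ip_self of_real_eq_iff .
  moreover have "0 \<le> (\<Sum>a<n. (cmod (residual n r u x a))\<^sup>2)" by (intro sum_nonneg) auto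
  ultimately show ?thesis by linarith
qed

definition unit_fun :: "nat \<Rightarrow> nat \<Rightarrow> complex" where
  "unit_fun b = (\<lambda>a. if a = b then 1 else 0)"

lemma ip_unit_fun_left: "b < n \<Longrightarrow> ip n (unit_fun b) v = cnj (v b)"
proof -
  assume "b < n"
  have "ip n (unit_fun b) v = (\<Sum>a<n. if a = b then cnj (v a) else 0)"
    unfolding ip_def unit_fun_def by (intro sum.cong) auto
  then show ?thesis using \<open>b < n\<close> by simp
qed

text \<open>
  The residuals of the standard basis vectors are the columns of the projection onto the
  orthogonal complement of the family. The squared moduli of the entries of a projection add up to
  its trace, here the dimension \<open>n - r\<close> of the complement.
\<close>

lemma residual_trace:
  assumes "orthonormal n r u"
  shows "(\<Sum>b<n. \<Sum>a<n. (cmod (residual n r u (unit_fun b) a))\<^sup>2) = real n - real r"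
proof -
  have "(\<Sum>a<n. (cmod (residual n r u (unit_fun b) a))\<^sup>2) = 1 - (\<Sum>i<r. (cmod (u i b))\<^sup>2)" if "b < n" for b
  proof -
    have *: "(cmod (unit_fun b a))\<^sup>2 = (if a = b then 1 else 0)" for a by (simp add: unit_fun_def)
    have "(\<Sum>a<n. (cmod (unit_fun b a))\<^sup>2) = 1" unfolding * using that by simp
    then show ?thesis
      using residual_norm[OF assms, of "unit_fun b"] that
      unfolding ip_self of_real_eq_iff by (simp add: ip_unit_fun_left)
  qed
  then have "(\<Sum>b<n. \<Sum>a<n. (cmod (residual n r u (unit_fun b) a))\<^sup>2)
      = real n - (\<Sum>b<n. \<Sum>i<r. (cmod (u i b))\<^sup>2)"
    by (simp add: sum_subtractf)
  also have "(\<Sum>b<n. \<Sum>i<r. (cmod (u i b))\<^sup>2) = (\<Sum>i<r. \<Sum>b<n. (cmod (u i b))\<^sup>2)"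
    by (rule sum.swap)
  also have "\<dots> = (\<Sum>i<r. 1)"
  proof (intro sum.cong refl)
    fix i assume "i \<in> {..<r}"
    then have "complex_of_real (\<Sum>b<n. (cmod (u i b))\<^sup>2) = complex_of_real 1"
      using orthonormalD[OF assms, of i i] unfolding ip_self by simp
    then show "(\<Sum>b<n. (cmod (u i b))\<^sup>2) = 1" unfolding of_real_eq_iff .
  qed
  finally show ?thesis by simp
qed

lemma normalise:
  assumes "a < n" "w a \<noteq> 0"
  obtains c :: complex where "ip n (\<lambda>a. c * w a) (\<lambda>a. c * w a) = 1"
proof -
  define S where "S = (\<Sum>a<n. (cmod (w a))\<^sup>2)"
  have "0 < S" unfolding S_def using assms by (intro sum_pos2[of _ a]) auto
  define c where "c = complex_of_real (1 / sqrt S)"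
  have "ip n (\<lambda>a. c * w a) (\<lambda>a. c * w a) = c * (cnj c * complex_of_real S)"
    unfolding ip_scale_left ip_scale_right ip_self S_def ..
  also have "\<dots> = complex_of_real (1 / sqrt S * (1 / sqrt S * S))"
    unfolding c_def complex_cnj_complex_of_real of_real_mult ..
  also have "1 / sqrt S * (1 / sqrt S * S) = 1" using \<open>0 < S\<close> by (simp add: field_simps)
  finally show ?thesis by (intro that[of c]) simp
qed

lemma orthonormal_add:
  assumes "orthonormal n r u" "ip n w w = 1" "\<And>i. i < r \<Longrightarrow> ip n w (u i) = 0"
  shows "orthonormal n (Suc r) (u(r := w))"
proof -
  have "ip n (u i) w = 0" if "i < r" for i
    using assms(3)[OF that] by (metis ip_cnj complex_cnj_zero)
  then show ?thesis using assms by (auto simp: orthonormal_def less_Suc_eq)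
qed

text \<open>
  If \<open>r < n\<close>, the trace just computed is nonzero, so some standard basis vector has a nonzero
  residual, and that residual can be normalised and added.
\<close>

lemma orthonormal_extend_one:
  assumes "orthonormal n r u" "r < n"
  shows "\<exists>w. orthonormal n (Suc r) (u(r := w))"
proof -
  have "(\<Sum>b<n. \<Sum>a<n. (cmod (residual n r u (unit_fun b) a))\<^sup>2) \<noteq> 0"
    unfolding residual_trace[OF assms(1)] using assms(2) by simp
  then obtain b where "b < n" "(\<Sum>a<n. (cmod (residual n r u (unit_fun b) a))\<^sup>2) \<noteq> 0"
    by (meson sum.neutral lessThan_iff)
  then obtain a where a: "a < n" "(cmod (residual n r u (unit_fun b) a))\<^sup>2 \<noteq> 0"
    by (meson sum.neutral lessThan_iff)
  then have "residual n r u (unit_fun b) a \<noteq> 0" by auto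
  then obtain c where c: "ip n (\<lambda>a. c * residual n r u (unit_fun b) a) (\<lambda>a. c * residual n r u (unit_fun b) a) = 1"
    using normalise a(1) by metis
  have "orthonormal n (Suc r) (u(r := (\<lambda>a. c * residual n r u (unit_fun b) a)))"
    using assms(1) c by (intro orthonormal_add) (auto simp: ip_scale_left residual_orthogonal)
  then show ?thesis by blast
qed

lemma orthonormal_extend:
  assumes "orthonormal n r u" "r \<le> n"
  shows "\<exists>e. orthonormal n n e \<and> (\<forall>i<r. e i = u i)"
  using assms(2,1)
proof (induction r arbitrary: u rule: inc_induct)
  case base
  then show ?case by (intro exI[of _ u]) simp
next
  case (step r)
  obtain w where "orthonormal n (Suc r) (u(r := w))"
    using orthonormal_extend_one[OF step.prems step.hyps(2)] by blast
  from step.IH[OF this] obtain e where e: "orthonormal n n e" "\<forall>i<Suc r. e i = (u(r := w)) i" by blast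
  then show ?case by (intro exI[of _ e]) auto
qed

text \<open>
  If \<open>r = n\<close>, the trace is zero, so the residuals of all standard basis vectors vanish.
\<close>

lemma orthonormal_complete:
  assumes "orthonormal n n u" "a < n" "b < n"
  shows "(\<Sum>i<n. u i a * cnj (u i b)) = (if a = b then 1 else 0)"
proof -
  have "(\<Sum>b<n. \<Sum>a<n. (cmod (residual n n u (unit_fun b) a))\<^sup>2) = 0"
    unfolding residual_trace[OF assms(1)] by simp
  then have "(\<Sum>a<n. (cmod (residual n n u (unit_fun b) a))\<^sup>2) = 0"
    using assms(3) by (subst (asm) sum_nonneg_eq_0_iff) (auto intro: sum_nonneg)
  then have "residual n n u (unit_fun b) a = 0"
    using assms(2) by (subst (asm) sum_nonneg_eq_0_iff) auto
  then show ?thesis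
    using assms(3) unfolding residual_def
    by (simp add: ip_unit_fun_left mult.commute) (auto simp: unit_fun_def split: if_splits)
qed

lemma orthonormal_expand:
  assumes "orthonormal n n u" "a < n"
  shows "(\<Sum>i<n. ip n x (u i) * u i a) = x a"
proof -
  have "(\<Sum>i<n. ip n x (u i) * u i a) = (\<Sum>i<n. \<Sum>b<n. x b * (u i a * cnj (u i b)))"
    unfolding ip_def sum_distrib_right by (simp add: algebra_simps)
  also have "\<dots> = (\<Sum>b<n. x b * (\<Sum>i<n. u i a * cnj (u i b)))"
    unfolding sum_distrib_left by (rule sum.swap)
  also have "\<dots> = (\<Sum>b<n. x b * (if a = b then 1 else 0))"
    by (intro sum.cong refl) (simp only: orthonormal_complete[OF assms] lessThan_iff)
  also have "\<dots> = x a" using assms(2) by (simp add: sum_times_delta)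
  finally show ?thesis .
qed

section \<open>The spectral theorem for Hermitian arrays\<close>

lemma matvec_sum: "matvec n H (\<lambda>b. \<Sum>i\<in>I. c i * f i b) a = (\<Sum>i\<in>I. c i * matvec n H (f i) a)"
  unfolding matvec_def sum_distrib_left by (subst sum.swap) (simp add: algebra_simps)

lemma matvec_scale: "matvec n H (\<lambda>b. c * f b) a = c * matvec n H f a"
  unfolding matvec_def sum_distrib_left by (simp add: algebra_simps)

lemma matvec_hermitian:
  assumes "\<And>a b. a < n \<Longrightarrow> b < n \<Longrightarrow> H b a = cnj (H a b)"
  shows "ip n (matvec n H v) w = ip n v (matvec n H w)"
proof -
  have "ip n (matvec n H v) w = (\<Sum>a<n. \<Sum>b<n. H a b * v b * cnj (w a))"
    by (simp add: ip_def matvec_def sum_distrib_right)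
  also have "\<dots> = (\<Sum>b<n. \<Sum>a<n. H a b * v b * cnj (w a))" by (rule sum.swap)
  also have "\<dots> = (\<Sum>b<n. \<Sum>a<n. v b * cnj (H b a * w a))"
  proof (intro sum.cong refl)
    fix b a assume "b \<in> {..<n}" "a \<in> {..<n}"
    then have "H a b = cnj (H b a)" by (intro assms) auto
    then show "H a b * v b * cnj (w a) = v b * cnj (H b a * w a)" by simp
  qed
  also have "\<dots> = ip n v (matvec n H w)" by (simp add: ip_def matvec_def sum_distrib_left)
  finally show ?thesis .
qed

lemma eigenvector_exists:
  fixes C :: "nat \<Rightarrow> nat \<Rightarrow> complex"
  assumes "0 < k"
  obtains z \<mu> where "\<exists>i<k. z i \<noteq> 0" "\<And>i. i < k \<Longrightarrow> (\<Sum>j<k. C i j * z j) = \<mu> * z i"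
proof -
  define A where "A = mat k k (\<lambda>(i, j). C i j)"
  have A: "A \<in> carrier_mat k k" by (simp add: A_def)
  have "spectrum A \<noteq> {}" by (rule spectrum_non_empty[OF A assms])
  then obtain \<mu> where "eigenvalue A \<mu>" by (auto simp: spectrum_def)
  then obtain v where v: "v \<in> carrier_vec k" "v \<noteq> 0\<^sub>v k" "A *\<^sub>v v = \<mu> \<cdot>\<^sub>v v"
    using A by (auto simp: eigenvalue_def eigenvector_def)
  have "\<exists>i<k. v $ i \<noteq> 0"
  proof (rule ccontr)
    assume "\<not> ?thesis"
    then have "v = 0\<^sub>v k" using v(1) by (intro eq_vecI) auto
    then show False using v(2) by simp
  qed
  moreover have "(\<Sum>j<k. C i j * v $ j) = \<mu> * v $ i" if "i < k" for i
  proof -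
    have "(A *\<^sub>v v) $ i = (\<Sum>j<k. C i j * v $ j)"
      using that v(1) by (simp add: A_def scalar_prod_def lessThan_atLeast0)
    then show ?thesis using v(1,3) that by simp
  qed
  ultimately show ?thesis using that by blast
qed

text \<open>
  Eigenvectors are found one at a time. A Hermitian operator leaves the orthogonal complement of
  the eigenvectors already found invariant, and an eigenvector of its compression to that
  complement, taken in an orthonormal basis of the complement, is an eigenvector of the operator.
\<close>

lemma hermitian_eigenfamily:
  assumes herm: "\<And>a b. a < n \<Longrightarrow> b < n \<Longrightarrow> H b a = cnj (H a b)" and "t \<le> n"
  shows "\<exists>u lam. orthonormal n t u \<and> (\<forall>i<t. \<forall>a<n. matvec n H (u i) a = lam i * u i a)"
  using assms(2)
proof (induction t)
  case 0
  then show ?case by (auto simp: orthonormal_def)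
next
  case (Suc t)
  then obtain u lam where u: "orthonormal n t u"
    and lam: "\<And>i a. i < t \<Longrightarrow> a < n \<Longrightarrow> matvec n H (u i) a = lam i * u i a" by auto
  obtain e where e: "orthonormal n n e" and eu: "\<And>i. i < t \<Longrightarrow> e i = u i"
    using orthonormal_extend[OF u] Suc.prems by auto
  \<comment> \<open>The dimension of the orthogonal complement.\<close>
  define k where "k = n - t"
  have "0 < k" and n: "n = t + k" using Suc.prems by (auto simp: k_def)
  obtain z \<mu> where z: "\<exists>i<k. z i \<noteq> 0"
    and \<mu>: "\<And>i. i < k \<Longrightarrow> (\<Sum>j<k. ip n (matvec n H (e (t + j))) (e (t + i)) * z j) = \<mu> * z i"
    using eigenvector_exists[OF \<open>0 < k\<close>, of "\<lambda>i j. ip n (matvec n H (e (t + j))) (e (t + i))"] by metis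
  have lt: "t + j < n" if "j < k" for j using that n by simp
  have lt': "i < n" if "i < t" for i using that n by simp
  define v where "v = (\<lambda>a. \<Sum>j<k. z j * e (t + j) a)"
  have v_low: "ip n v (e i) = 0" if "i < t" for i
    unfolding v_def ip_sum_left ip_scale_left
    by (intro sum.neutral ballI) (use that in \<open>simp add: orthonormalD[OF e] lt lt'\<close>)
  have v_high: "ip n v (e (t + i)) = z i" if "i < k" for i
  proof -
    have "ip n v (e (t + i)) = (\<Sum>j<k. z j * (if j = i then 1 else 0))"
      unfolding v_def ip_sum_left ip_scale_left
      by (intro sum.cong refl) (use that in \<open>simp add: orthonormalD[OF e] lt lt'\<close>)
    then show ?thesis using that by (simp add: sum_times_delta)
  qed
  have Hv_low: "ip n (matvec n H v) (e i) = 0" if "i < t" for i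
  proof -
    have "ip n (matvec n H v) (e i) = ip n v (matvec n H (e i))" by (rule matvec_hermitian[OF herm])
    also have "\<dots> = ip n v (\<lambda>a. lam i * e i a)" using lam eu that by (intro ip_cong) auto
    also have "\<dots> = 0" using v_low[OF that] by (simp add: ip_scale_right)
    finally show ?thesis .
  qed
  have Hv_high: "ip n (matvec n H v) (e (t + i)) = \<mu> * z i" if "i < k" for i
  proof -
    have "matvec n H v = (\<lambda>a. \<Sum>j<k. z j * matvec n H (e (t + j)) a)"
      unfolding v_def by (rule ext) (rule matvec_sum)
    then have "ip n (matvec n H v) (e (t + i)) = (\<Sum>j<k. z j * ip n (matvec n H (e (t + j))) (e (t + i)))"
      by (simp add: ip_sum_left ip_scale_left)
    then show ?thesis using \<mu>[OF that] by (simp add: mult.commute)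
  qed
  have eigen: "matvec n H v a = \<mu> * v a" if "a < n" for a
  proof -
    have "matvec n H v a = (\<Sum>i<t + k. ip n (matvec n H v) (e i) * e i a)"
      using orthonormal_expand[OF e that, of "matvec n H v"] n by metis
    also have "\<dots> = (\<Sum>i<t. ip n (matvec n H v) (e i) * e i a)
        + (\<Sum>i<k. ip n (matvec n H v) (e (t + i)) * e (t + i) a)"
      by (induction k) (simp_all add: add.assoc)
    also have "\<dots> = (\<Sum>i<k. \<mu> * z i * e (t + i) a)" by (simp add: Hv_low Hv_high)
    also have "\<dots> = \<mu> * v a" by (simp add: v_def sum_distrib_left algebra_simps)
    finally show ?thesis .
  qed
  have "\<not> (\<forall>a<n. v a = 0)"
  proof
    assume "\<forall>a<n. v a = 0"
    then have "ip n v w = 0" for w by (simp add: ip_def)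
    then show False using v_high z by metis
  qed
  then obtain c where c: "ip n (\<lambda>a. c * v a) (\<lambda>a. c * v a) = 1" using normalise by metis
  have "orthonormal n (Suc t) (u(t := (\<lambda>a. c * v a)))"
    using u c v_low eu by (intro orthonormal_add) (auto simp: ip_scale_left)
  moreover have "\<forall>i<Suc t. \<forall>a<n. matvec n H ((u(t := (\<lambda>a. c * v a))) i) a
      = (lam(t := \<mu>)) i * (u(t := (\<lambda>a. c * v a))) i a"
    using lam eigen by (auto simp: less_Suc_eq matvec_scale)
  ultimately show ?case by blast
qed

text \<open>
  The eigenvalues are real because the operator is self-adjoint, and inserting the completeness
  relation of the eigenbasis into \<open>H\<close> gives the sum of rank-one terms.
\<close>

lemma spectral:
  assumes herm: "\<And>a b. a < n \<Longrightarrow> b < n \<Longrightarrow> H b a = cnj (H a b)"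
  obtains u :: "nat \<Rightarrow> nat \<Rightarrow> complex" and lam :: "nat \<Rightarrow> real" where "orthonormal n n u"
    "\<And>i a. i < n \<Longrightarrow> a < n \<Longrightarrow> matvec n H (u i) a = lam i * u i a"
    "\<And>a b. a < n \<Longrightarrow> b < n \<Longrightarrow> H a b = (\<Sum>i<n. lam i * (u i a * cnj (u i b)))"
proof -
  obtain u lam where u: "orthonormal n n u"
    and lam: "\<And>i a. i < n \<Longrightarrow> a < n \<Longrightarrow> matvec n H (u i) a = lam i * u i a"
    using hermitian_eigenfamily[of n H n, OF herm order_refl] by blast
  have real: "lam i = complex_of_real (Re (lam i))" if "i < n" for i
  proof -
    have "ip n (matvec n H (u i)) (u i) = ip n (\<lambda>a. lam i * u i a) (u i)"
      using lam that by (intro ip_cong) auto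
    then have 1: "ip n (matvec n H (u i)) (u i) = lam i"
      using that by (simp add: ip_scale_left orthonormalD[OF u])
    have "ip n (u i) (matvec n H (u i)) = ip n (u i) (\<lambda>a. lam i * u i a)"
      using lam that by (intro ip_cong) auto
    then have "ip n (u i) (matvec n H (u i)) = cnj (lam i)"
      using that by (simp add: ip_scale_right orthonormalD[OF u])
    then have "lam i = cnj (lam i)" using 1 matvec_hermitian[of n H "u i" "u i", OF herm] by simp
    then show ?thesis by (simp add: complex_eq_iff)
  qed
  show ?thesis
  proof (rule that[OF u])
    show "matvec n H (u i) a = complex_of_real (Re (lam i)) * u i a" if "i < n" "a < n" for i a
      using lam[OF that] real[OF that(1)] by metis
    show "H a b = (\<Sum>i<n. complex_of_real (Re (lam i)) * (u i a * cnj (u i b)))" if "a < n" "b < n" for a b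
    proof -
      have "(\<Sum>i<n. complex_of_real (Re (lam i)) * (u i a * cnj (u i b)))
          = (\<Sum>i<n. \<Sum>c<n. H a c * (u i c * cnj (u i b)))"
      proof (intro sum.cong refl)
        fix i assume "i \<in> {..<n}"
        then have "complex_of_real (Re (lam i)) * u i a = matvec n H (u i) a"
          using lam[of i a] real[of i] that by (metis lessThan_iff)
        then show "complex_of_real (Re (lam i)) * (u i a * cnj (u i b)) = (\<Sum>c<n. H a c * (u i c * cnj (u i b)))"
          by (simp add: matvec_def sum_distrib_right mult.assoc[symmetric])
      qed
      also have "\<dots> = (\<Sum>c<n. H a c * (\<Sum>i<n. u i c * cnj (u i b)))"
        unfolding sum_distrib_left by (rule sum.swap)
      also have "\<dots> = (\<Sum>c<n. H a c * (if c = b then 1 else 0))"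
        by (intro sum.cong refl) (simp only: orthonormal_complete[OF u] that lessThan_iff)
      also have "\<dots> = H a b" using that by (simp add: sum_times_delta)
      finally show ?thesis by simp
    qed
  qed
qed

section \<open>Positive forms and their Gram vectors\<close>

definition pos_form :: "nat \<Rightarrow> (nat \<Rightarrow> nat \<Rightarrow> complex) \<Rightarrow> bool" where
  "pos_form n Y \<longleftrightarrow> (\<forall>v. 0 \<le> ip n (matvec n Y v) v)"

definition gram :: "(nat \<Rightarrow> complex) list \<Rightarrow> nat \<Rightarrow> nat \<Rightarrow> complex" where
  "gram gs a b = (\<Sum>g\<leftarrow>gs. g a * cnj (g b))"

lemma gram_simps [simp]:
  "gram [] a b = 0"
  "gram (g # gs) a b = g a * cnj (g b) + gram gs a b"
  "gram (gs @ hs) a b = gram gs a b + gram hs a b"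
  by (simp_all add: gram_def)

lemma matvec_add: "matvec n H (\<lambda>b. f b + g b) a = matvec n H f a + matvec n H g a"
  by (simp add: matvec_def sum.distrib algebra_simps)

lemma matvec_diff: "matvec n H (\<lambda>b. f b - g b) a = matvec n H f a - matvec n H g a"
  by (simp add: matvec_def sum_subtractf algebra_simps)

lemma form_cong:
  assumes "\<And>a b. a < n \<Longrightarrow> b < n \<Longrightarrow> Y a b = Z a b"
  shows "ip n (matvec n Y v) w = ip n (matvec n Z v) w"
  using assms by (intro ip_cong refl) (simp add: matvec_def)

lemma pos_form_cong:
  assumes "\<And>a b. a < n \<Longrightarrow> b < n \<Longrightarrow> Y a b = Z a b"
  shows "pos_form n Y \<longleftrightarrow> pos_form n Z"
  unfolding pos_form_def by (simp add: form_cong[OF assms])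

lemma form_rank_one:
  "ip n (matvec n (\<lambda>a b. q a * cnj (q b)) v) w = ip n v q * cnj (ip n w q)"
proof -
  have "matvec n (\<lambda>a b. q a * cnj (q b)) v = (\<lambda>a. ip n v q * q a)"
    by (rule ext) (simp add: matvec_def ip_def sum_distrib_left mult_ac)
  then show ?thesis by (simp add: ip_scale_left ip_cnj)
qed

lemma form_minus_rank_one:
  "ip n (matvec n (\<lambda>a b. Y a b - q a * cnj (q b)) v) v
     = ip n (matvec n Y v) v - complex_of_real ((cmod (ip n v q))\<^sup>2)"
proof -
  have "matvec n (\<lambda>a b. Y a b - q a * cnj (q b)) v
      = (\<lambda>a. matvec n Y v a - matvec n (\<lambda>a b. q a * cnj (q b)) v a)"
    by (rule ext) (simp add: matvec_def sum_subtractf left_diff_distrib)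
  then show ?thesis
    by (simp only: ip_diff_left form_rank_one complex_norm_square)
qed

lemma pos_form_gram:
  "pos_form n (gram gs)"
proof (induction gs)
  case Nil
  then show ?case by (simp add: pos_form_def matvec_def ip_def)
next
  case (Cons g gs)
  show ?case unfolding pos_form_def
  proof
    fix v
    have "matvec n (gram (g # gs)) v = (\<lambda>a. matvec n (\<lambda>a b. g a * cnj (g b)) v a + matvec n (gram gs) v a)"
      by (rule ext) (simp add: matvec_def sum.distrib distrib_right)
    then have "ip n (matvec n (gram (g # gs)) v) v
       = ip n v g * cnj (ip n v g) + ip n (matvec n (gram gs) v) v"
      by (simp only: ip_add_left form_rank_one)
    moreover have "0 \<le> ip n v g * cnj (ip n v g)"
      unfolding complex_norm_square[symmetric] by (simp add: less_eq_complex_def)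
    moreover have "0 \<le> ip n (matvec n (gram gs) v) v" using Cons by (simp add: pos_form_def)
    ultimately show "0 \<le> ip n (matvec n (gram (g # gs)) v) v"
      by (simp add: less_eq_complex_def)
  qed
qed

lemma ip_unit_fun_right: "b < n \<Longrightarrow> ip n v (unit_fun b) = v b"
  using ip_unit_fun_left[of b n v] by (metis ip_cnj complex_cnj_cnj)

lemma matvec_unit_fun: "b < n \<Longrightarrow> matvec n H (unit_fun b) a = H a b"
  unfolding matvec_def unit_fun_def by (simp add: sum_times_delta)

text \<open>
  Polarisation: the form is real on the combinations \<open>e\<^sub>a + e\<^sub>b\<close> and \<open>e\<^sub>a + \<i> e\<^sub>b\<close>.
\<close>

lemma pos_form_hermitian:
  assumes "pos_form n Y" "a < n" "b < n"
  shows "Y b a = cnj (Y a b)"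
proof -
  have im: "Im (ip n (matvec n Y v) v) = 0" for v
    using assms(1) by (simp add: pos_form_def less_eq_complex_def)
  have diag: "Im (Y c c) = 0" if "c < n" for c
    using im[of "unit_fun c"] that by (simp add: ip_unit_fun_right matvec_unit_fun)
  have expand: "ip n (matvec n Y (\<lambda>x. unit_fun a x + c * unit_fun b x)) (\<lambda>x. unit_fun a x + c * unit_fun b x)
      = Y a a + cnj c * Y b a + c * Y a b + c * cnj c * Y b b" for c
  proof -
    have "matvec n Y (\<lambda>x. unit_fun a x + c * unit_fun b x) = (\<lambda>x. matvec n Y (unit_fun a) x + c * matvec n Y (unit_fun b) x)"
      by (rule ext) (simp add: matvec_add matvec_scale)
    then show ?thesis using assms(2,3)
      by (simp add: ip_linear ip_unit_fun_right matvec_unit_fun algebra_simps)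
  qed
  have "Im (Y b a) + Im (Y a b) = 0"
    using im[of "\<lambda>x. unit_fun a x + 1 * unit_fun b x"] diag assms(2,3) unfolding expand by simp
  moreover have "Re (Y a b) - Re (Y b a) = 0"
    using im[of "\<lambda>x. unit_fun a x + \<i> * unit_fun b x"] diag assms(2,3) unfolding expand by simp
  ultimately show ?thesis by (simp add: complex_eq_iff)
qed

lemma pos_form_eigenvalue:
  assumes "pos_form n Y" "orthonormal n n u" "i < n"
    and "\<And>a. a < n \<Longrightarrow> matvec n Y (u i) a = complex_of_real c * u i a"
  shows "ip n (matvec n Y (u i)) (u i) = complex_of_real c" "0 \<le> c"
proof -
  have "ip n (matvec n Y (u i)) (u i) = ip n (\<lambda>a. complex_of_real c * u i a) (u i)"
    using assms(4) by (intro ip_cong) auto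
  then show *: "ip n (matvec n Y (u i)) (u i) = complex_of_real c"
    using assms(3) by (simp add: ip_scale_left orthonormalD[OF assms(2)])
  have "0 \<le> ip n (matvec n Y (u i)) (u i)" using assms(1) by (simp add: pos_form_def)
  then show "0 \<le> c" unfolding * by (simp add: less_eq_complex_def)
qed

text \<open>
  The Gram vectors are the eigenvectors scaled by the square roots of the eigenvalues.
\<close>

lemma pos_form_imp_gram:
  assumes "pos_form n Y"
  obtains gs where "\<And>a b. a < n \<Longrightarrow> b < n \<Longrightarrow> Y a b = gram gs a b"
proof -
  obtain u lam where u: "orthonormal n n u"
    and lam: "\<And>i a. i < n \<Longrightarrow> a < n \<Longrightarrow> matvec n Y (u i) a = complex_of_real (lam i) * u i a"
    and Y: "\<And>a b. a < n \<Longrightarrow> b < n \<Longrightarrow> Y a b = (\<Sum>i<n. lam i * (u i a * cnj (u i b)))"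
    using spectral[of n Y] pos_form_hermitian[OF assms] by blast
  have nonneg: "0 \<le> lam i" if "i < n" for i
    using pos_form_eigenvalue(2)[OF assms u that] lam that by blast
  define gs where "gs = map (\<lambda>i a. complex_of_real (sqrt (lam i)) * u i a) [0..<n]"
  have "Y a b = gram gs a b" if "a < n" "b < n" for a b
  proof -
    have "gram gs a b = (\<Sum>i<n. complex_of_real (sqrt (lam i)) * u i a * cnj (complex_of_real (sqrt (lam i)) * u i b))"
      unfolding gram_def gs_def
      by (simp add: comp_def interv_sum_list_conv_sum_set_nat lessThan_atLeast0)
    also have "\<dots> = (\<Sum>i<n. complex_of_real (sqrt (lam i) * sqrt (lam i)) * (u i a * cnj (u i b)))"
      by (intro sum.cong refl)
        (simp only: of_real_mult complex_cnj_mult complex_cnj_complex_of_real mult_ac)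
    also have "\<dots> = (\<Sum>i<n. complex_of_real (lam i) * (u i a * cnj (u i b)))"
      by (intro sum.cong refl) (metis nonneg lessThan_iff real_sqrt_mult_self abs_of_nonneg)
    finally show ?thesis using Y[OF that] by simp
  qed
  then show ?thesis using that by blast
qed

section \<open>Extending a decomposition of a leading block\<close>

lemma sum_truncate:
  assumes "k \<le> (n::nat)"
  shows "(\<Sum>a<n. if a < k then f a else (0::complex)) = (\<Sum>a<k. f a)"
proof -
  have "(\<Sum>a<n. if a < k then f a else 0) = (\<Sum>a\<in>{..<n} \<inter> {..<k}. f a)"
    by (subst sum.inter_restrict) auto
  also have "{..<n} \<inter> {..<k} = {..<k}" using assms by auto
  finally show ?thesis .
qed

lemma matvec_truncate:
  assumes "k \<le> n"
  shows "matvec n Y (\<lambda>a. if a < k then z a else 0) = matvec k Y z"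
proof
  fix a
  have "matvec n Y (\<lambda>a. if a < k then z a else 0) a = (\<Sum>b<n. if b < k then Y a b * z b else 0)"
    unfolding matvec_def by (intro sum.cong) auto
  then show "matvec n Y (\<lambda>a. if a < k then z a else 0) a = matvec k Y z a"
    by (simp only: sum_truncate[OF assms] matvec_def)
qed

lemma ip_truncate:
  assumes "k \<le> n"
  shows "ip n v (\<lambda>a. if a < k then z a else 0) = ip k v z"
proof -
  have "ip n v (\<lambda>a. if a < k then z a else 0) = (\<Sum>b<n. if b < k then v b * cnj (z b) else 0)"
    unfolding ip_def by (intro sum.cong) auto
  then show ?thesis by (simp only: sum_truncate[OF assms] ip_def)
qed

lemma pos_form_truncate:
  assumes "pos_form n Y" "k \<le> n"
  shows "pos_form k Y"
  unfolding pos_form_def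
proof
  fix v
  have "ip n (matvec n Y (\<lambda>a. if a < k then v a else 0)) (\<lambda>a. if a < k then v a else 0) = ip k (matvec k Y v) v"
    unfolding ip_truncate[OF assms(2)] matvec_truncate[OF assms(2)] ..
  then show "0 \<le> ip k (matvec k Y v) v" using assms(1) unfolding pos_form_def by metis
qed

text \<open>
  An eigenvector of \<open>Y\<close> with eigenvalue 0 is orthogonal to \<open>p\<close>, since \<open>Y - |p\<rangle>\<langle>p|\<close> is nonnegative on
  it. So \<open>p\<close> is spanned by eigenvectors with nonzero eigenvalues and \<open>Y\<close> can be inverted on it.
\<close>

lemma range_of_dominating_form:
  assumes Y: "pos_form k Y" and dom: "pos_form k (\<lambda>a b. Y a b - p a * cnj (p b))"
  obtains z where "\<And>a. a < k \<Longrightarrow> matvec k Y z a = p a"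
proof -
  obtain u lam where u: "orthonormal k k u"
    and lam: "\<And>i a. i < k \<Longrightarrow> a < k \<Longrightarrow> matvec k Y (u i) a = complex_of_real (lam i) * u i a"
    and "\<And>a b. a < k \<Longrightarrow> b < k \<Longrightarrow> Y a b = (\<Sum>i<k. lam i * (u i a * cnj (u i b)))"
    using spectral[of k Y] pos_form_hermitian[OF Y] by blast
  have null: "ip k p (u i) = 0" if "i < k" "lam i = 0" for i
  proof -
    \<comment> \<open>The form \<open>Y - |p\<rangle>\<langle>p|\<close> evaluated at the eigenvector.\<close>
    have "0 \<le> ip k (matvec k Y (u i)) (u i) - complex_of_real ((cmod (ip k (u i) p))\<^sup>2)"
      using dom unfolding pos_form_def form_minus_rank_one by blast
    moreover have "ip k (matvec k Y (u i)) (u i) = 0"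
      using pos_form_eigenvalue(1)[OF Y u that(1), of "lam i"] lam that by simp
    ultimately have "(cmod (ip k (u i) p))\<^sup>2 \<le> 0" by (simp add: less_eq_complex_def)
    then have "ip k (u i) p = 0" by simp
    then show ?thesis by (metis ip_cnj complex_cnj_zero)
  qed
  define z where "z = (\<lambda>a. \<Sum>i<k. (ip k p (u i) / complex_of_real (lam i)) * u i a)"
  have "matvec k Y z a = p a" if "a < k" for a
  proof -
    have "matvec k Y z a = (\<Sum>i<k. (ip k p (u i) / complex_of_real (lam i)) * matvec k Y (u i) a)"
      unfolding z_def by (rule matvec_sum)
    also have "\<dots> = (\<Sum>i<k. ip k p (u i) * u i a)"
      by (intro sum.cong refl) (use lam null that in \<open>auto simp: field_simps\<close>)
    also have "\<dots> = p a" by (rule orthonormal_expand[OF u that])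
    finally show ?thesis .
  qed
  then show ?thesis using that by blast
qed

text \<open>
  With \<open>z\<close> such that \<open>Y z = p\<close> on the leading block, the vector \<open>q = Y z\<close> of full length prolongs
  \<open>p\<close>. The domination of \<open>|p\<rangle>\<langle>p|\<close> gives \<open>\<langle>Y z, z\<rangle> \<le> 1\<close>, and the Cauchy-Schwarz inequality for the
  form \<open>Y\<close> turns this into \<open>|\<langle>v, q\<rangle>|\<^sup>2 \<le> \<langle>Y v, v\<rangle>\<close>, which says that \<open>Y - |q\<rangle>\<langle>q|\<close> is positive.
\<close>

lemma rank_one_extension:
  assumes Y: "pos_form n Y" and "k \<le> n"
    and dom: "pos_form k (\<lambda>a b. Y a b - p a * cnj (p b))"
  obtains q where "\<And>a. a < k \<Longrightarrow> q a = p a" "pos_form n (\<lambda>a b. Y a b - q a * cnj (q b))"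
proof -
  obtain z where z: "\<And>a. a < k \<Longrightarrow> matvec k Y z a = p a"
    using range_of_dominating_form[OF pos_form_truncate[OF Y \<open>k \<le> n\<close>] dom] by blast
  define z' where "z' = (\<lambda>a. if a < k then z a else 0)"
  define q where "q = matvec n Y z'"
  have q: "q a = p a" if "a < k" for a
    unfolding q_def z'_def matvec_truncate[OF \<open>k \<le> n\<close>] by (rule z[OF that])
  define \<beta> where "\<beta> = ip n q z'"
  have \<beta>: "\<beta> = ip k (matvec k Y z) z"
    unfolding \<beta>_def q_def z'_def ip_truncate[OF \<open>k \<le> n\<close>] matvec_truncate[OF \<open>k \<le> n\<close>] ..
  have \<beta>': "\<beta> = ip k p z" unfolding \<beta> using z by (intro ip_cong) auto
  have "0 \<le> \<beta>" using Y unfolding pos_form_def \<beta>_def q_def by blast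
  have "0 \<le> ip k (matvec k Y z) z - complex_of_real ((cmod (ip k z p))\<^sup>2)"
    using dom unfolding pos_form_def form_minus_rank_one by blast
  also have "ip k z p = cnj \<beta>" by (simp add: \<beta>' ip_cnj)
  finally have "0 \<le> \<beta> - complex_of_real ((cmod \<beta>)\<^sup>2)" by (simp add: \<beta>)
  then have "(Re \<beta>)\<^sup>2 \<le> Re \<beta>"
    using \<open>0 \<le> \<beta>\<close> by (auto simp: less_eq_complex_def cmod_power2)
  have "Re \<beta> \<le> 1"
  proof (rule ccontr)
    assume "\<not> Re \<beta> \<le> 1"
    then have "1 * Re \<beta> < Re \<beta> * Re \<beta>" by (intro mult_strict_right_mono) auto
    then show False using \<open>(Re \<beta>)\<^sup>2 \<le> Re \<beta>\<close> by (simp add: power2_eq_square)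
  qed
  have "pos_form n (\<lambda>a b. Y a b - q a * cnj (q b))"
    unfolding pos_form_def form_minus_rank_one
  proof
    fix v
    define t where "t = ip n v q"
    have t: "ip n (matvec n Y v) z' = t"
      unfolding t_def q_def by (intro matvec_hermitian pos_form_hermitian[OF Y])
    have t': "ip n (matvec n Y z') v = cnj t" unfolding t_def q_def by (simp add: ip_cnj)
    have zz: "ip n (matvec n Y z') z' = \<beta>" by (simp add: \<beta>_def q_def)
    \<comment> \<open>The form at \<open>v - t z'\<close> equals \<open>\<langle>Y v, v\<rangle> - |t|\<^sup>2 - |t|\<^sup>2 (1 - \<beta>)\<close>; as \<open>\<beta> \<le> 1\<close>, the last
      term can be dropped.\<close>
    let ?x = "\<lambda>a. v a - t * z' a"
    have "matvec n Y ?x = (\<lambda>a. matvec n Y v a - t * matvec n Y z' a)"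
      by (rule ext) (simp add: matvec_diff matvec_scale)
    then have "ip n (matvec n Y ?x) ?x = ip n (matvec n Y v) v - t * cnj t - cnj t * (t - t * \<beta>)"
      by (simp add: ip_linear t t' zz algebra_simps)
    also have "\<dots> = ip n (matvec n Y v) v - t * cnj t - t * cnj t * (1 - \<beta>)"
      by (simp add: algebra_simps)
    finally have "0 \<le> ip n (matvec n Y v) v - t * cnj t - t * cnj t * (1 - \<beta>)"
      using Y unfolding pos_form_def by metis
    then have "0 \<le> ip n (matvec n Y v) v - of_real ((cmod t)\<^sup>2) - of_real ((cmod t)\<^sup>2) * (1 - \<beta>)"
      by (simp only: complex_norm_square)
    moreover have "0 \<le> (cmod t)\<^sup>2 * (1 - Re \<beta>)" using \<open>Re \<beta> \<le> 1\<close> by simp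
    ultimately show "0 \<le> ip n (matvec n Y v) v - complex_of_real ((cmod (ip n v q))\<^sup>2)"
      using \<open>0 \<le> \<beta>\<close> unfolding t_def[symmetric] by (simp add: less_eq_complex_def)
  qed
  then show ?thesis using that q by blast
qed

lemma gram_diag_zero:
  assumes "gram gs a a = 0" "g \<in> set gs"
  shows "g a = 0"
proof -
  have "gram gs a a = complex_of_real (\<Sum>g\<leftarrow>gs. (cmod (g a))\<^sup>2)"
    by (induction gs) (simp_all only: gram_simps list.map sum_list.Nil sum_list.Cons of_real_add complex_norm_square of_real_0)
  then have "(\<Sum>g\<leftarrow>gs. (cmod (g a))\<^sup>2) = 0" using assms(1) by simp
  then have "(cmod (g a))\<^sup>2 = 0"
    using assms(2) by (subst (asm) sum_list_nonneg_eq_0_iff) auto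
  then show ?thesis by simp
qed

text \<open>
  The terms \<open>|p\<rangle>\<langle>p|\<close> are prolonged and split off one after the other. What remains is a positive form
  that vanishes on the leading block, so its Gram vectors vanish there.
\<close>

lemma block_extension:
  assumes "pos_form n Y" "k \<le> n" "\<And>a b. a < k \<Longrightarrow> b < k \<Longrightarrow> Y a b = gram ps a b"
  shows "\<exists>qs hs. (\<forall>q\<in>set qs. \<exists>p\<in>set ps. \<forall>a<k. q a = p a) \<and> (\<forall>h\<in>set hs. \<forall>a<k. h a = 0) \<and>
    (\<forall>a<n. \<forall>b<n. Y a b = gram (qs @ hs) a b)"
  using assms(1,3)
proof (induction ps arbitrary: Y)
  case Nil
  obtain hs where hs: "\<And>a b. a < n \<Longrightarrow> b < n \<Longrightarrow> Y a b = gram hs a b"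
    using pos_form_imp_gram[OF Nil.prems(1)] by blast
  have "h a = 0" if "h \<in> set hs" "a < k" for h a
    using gram_diag_zero[OF _ that(1), of a] hs[of a a] Nil.prems(2)[of a a] that(2) \<open>k \<le> n\<close> by simp
  then show ?case using hs by (intro exI[of _ "[]"] exI[of _ hs]) simp
next
  case (Cons p ps)
  have eq: "Y a b - p a * cnj (p b) = gram ps a b" if "a < k" "b < k" for a b
    using Cons.prems(2)[OF that] by simp
  have "pos_form k (\<lambda>a b. Y a b - p a * cnj (p b))"
    using pos_form_cong[of k "\<lambda>a b. Y a b - p a * cnj (p b)" "gram ps"] eq pos_form_gram by blast
  then obtain q where q: "\<And>a. a < k \<Longrightarrow> q a = p a"
    and pos: "pos_form n (\<lambda>a b. Y a b - q a * cnj (q b))"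
    using rank_one_extension[OF Cons.prems(1) \<open>k \<le> n\<close>] by blast
  have "Y a b - q a * cnj (q b) = gram ps a b" if "a < k" "b < k" for a b
    using eq[OF that] q that by simp
  from Cons.IH[OF pos this] obtain qs hs where
    qs: "\<forall>q\<in>set qs. \<exists>p\<in>set ps. \<forall>a<k. q a = p a" and hs: "\<forall>h\<in>set hs. \<forall>a<k. h a = 0"
    and Y: "\<forall>a<n. \<forall>b<n. Y a b - q a * cnj (q b) = gram (qs @ hs) a b" by blast
  have "\<forall>a<n. \<forall>b<n. Y a b = gram ((q # qs) @ hs) a b" 
    using Y by (simp add: diff_eq_eq add_ac)
  then show ?case using qs hs q by (intro exI[of _ "q # qs"] exI[of _ hs]) auto
qed

section \<open>Tensors of bounded Schmidt number\<close>

text \<open>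
  A function \<open>g u x\<close> of two indices stands for a vector in \<open>C\<^sup>n \<otimes> C\<^sup>d\<close>. Sums of \<open>s\<close> arbitrary product
  vectors describe Schmidt rank at most \<open>s\<close> and, unlike decompositions into orthonormal vectors,
  are visibly preserved by maps acting on one factor.
\<close>

definition schmidt_le :: "nat \<Rightarrow> nat \<Rightarrow> nat \<Rightarrow> (nat \<Rightarrow> nat \<Rightarrow> complex) \<Rightarrow> bool" where
  "schmidt_le n d s g \<longleftrightarrow>
     (\<exists>\<alpha> \<beta>. \<forall>u<n. \<forall>x<d. g u x = (\<Sum>j<s. \<alpha> j u * \<beta> j x))"

text \<open>
  A function \<open>F u x v y\<close> stands for the matrix in \<open>M\<^sub>n \<otimes> M\<^sub>d\<close> with row index \<open>(u, x)\<close> and column index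
  \<open>(v, y)\<close>; the predicate expresses that it is positive with Schmidt number at most \<open>s\<close>. The list of
  vectors may be empty, so that 0 satisfies the predicate for every \<open>s\<close>.
\<close>

definition sn_le ::
  "nat \<Rightarrow> nat \<Rightarrow> nat \<Rightarrow> (nat \<Rightarrow> nat \<Rightarrow> nat \<Rightarrow> nat \<Rightarrow> complex) \<Rightarrow> bool" where
  "sn_le n d s F \<longleftrightarrow> (\<exists>gs. (\<forall>g\<in>set gs. schmidt_le n d s g) \<and>
     (\<forall>u<n. \<forall>x<d. \<forall>v<n. \<forall>y<d. F u x v y = (\<Sum>g\<leftarrow>gs. g u x * cnj (g v y))))"

lemma schmidt_leI:
  assumes "\<And>u x. u < n \<Longrightarrow> x < d \<Longrightarrow> g u x = (\<Sum>j<s. \<alpha> j u * \<beta> j x)"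
  shows "schmidt_le n d s g"
  using assms unfolding schmidt_le_def by blast

lemma schmidt_le_mono:
  assumes "schmidt_le n d s g" "s \<le> t"
  shows "schmidt_le n d t g"
proof -
  obtain \<alpha> \<beta> where g: "\<forall>u<n. \<forall>x<d. g u x = (\<Sum>j<s. \<alpha> j u * \<beta> j x)"
    using assms(1) by (auto simp: schmidt_le_def)
  have "(\<Sum>j<t. (if j < s then \<alpha> j u else 0) * \<beta> j x) = (\<Sum>j<s. \<alpha> j u * \<beta> j x)" for u x
  proof -
    have "(\<Sum>j<t. (if j < s then \<alpha> j u else 0) * \<beta> j x) = (\<Sum>j<t. if j < s then \<alpha> j u * \<beta> j x else 0)"
      by (intro sum.cong) auto
    then show ?thesis by (simp only: sum_truncate[OF assms(2)])
  qed
  then show ?thesis using g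
    by (intro schmidt_leI[where \<alpha> = "\<lambda>j u. if j < s then \<alpha> j u else 0" and \<beta> = \<beta>]) simp
qed

lemma schmidt_le_full: "schmidt_le n d d g"
proof (rule schmidt_leI)
  fix u x assume "x < d"
  then show "g u x = (\<Sum>j<d. g u j * (if j = x then 1 else 0))"
    by (simp add: sum_times_delta)
qed

lemma sn_leI:
  assumes "\<And>g. g \<in> set gs \<Longrightarrow> schmidt_le n d s g"
    "\<And>u x v y. u < n \<Longrightarrow> x < d \<Longrightarrow> v < n \<Longrightarrow> y < d \<Longrightarrow> F u x v y = (\<Sum>g\<leftarrow>gs. g u x * cnj (g v y))"
  shows "sn_le n d s F"
  using assms unfolding sn_le_def by blast

lemma sn_leE:
  assumes "sn_le n d s F"
  obtains gs where "\<And>g. g \<in> set gs \<Longrightarrow> schmidt_le n d s g"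
    "\<And>u x v y. u < n \<Longrightarrow> x < d \<Longrightarrow> v < n \<Longrightarrow> y < d \<Longrightarrow> F u x v y = (\<Sum>g\<leftarrow>gs. g u x * cnj (g v y))"
  using assms unfolding sn_le_def by blast

lemma sn_le_mono: "sn_le n d s F \<Longrightarrow> s \<le> t \<Longrightarrow> sn_le n d t F"
  unfolding sn_le_def using schmidt_le_mono by blast

lemma sn_le_cong:
  assumes "sn_le n d s F"
    "\<And>u x v y. u < n \<Longrightarrow> x < d \<Longrightarrow> v < n \<Longrightarrow> y < d \<Longrightarrow> G u x v y = F u x v y"
  shows "sn_le n d s G"
  using assms unfolding sn_le_def by simp

lemma sn_le_zero: "sn_le n d s (\<lambda>u x v y. 0)"
  by (rule sn_leI[of "[]"]) auto

lemma sn_le_add: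
  assumes "sn_le n d s F" "sn_le n d s G"
  shows "sn_le n d s (\<lambda>u x v y. F u x v y + G u x v y)"
proof -
  obtain gs where gs: "\<And>g. g \<in> set gs \<Longrightarrow> schmidt_le n d s g"
    "\<And>u x v y. u < n \<Longrightarrow> x < d \<Longrightarrow> v < n \<Longrightarrow> y < d \<Longrightarrow> F u x v y = (\<Sum>g\<leftarrow>gs. g u x * cnj (g v y))"
    using sn_leE[OF assms(1)] by blast
  obtain hs where hs: "\<And>g. g \<in> set hs \<Longrightarrow> schmidt_le n d s g"
    "\<And>u x v y. u < n \<Longrightarrow> x < d \<Longrightarrow> v < n \<Longrightarrow> y < d \<Longrightarrow> G u x v y = (\<Sum>g\<leftarrow>hs. g u x * cnj (g v y))"
    using sn_leE[OF assms(2)] by blast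
  show ?thesis using gs hs by (intro sn_leI[of "gs @ hs"]) auto
qed

lemma sn_le_sum_list:
  assumes "\<And>g. g \<in> set gs \<Longrightarrow> sn_le n d s (F g)"
  shows "sn_le n d s (\<lambda>u x v y. \<Sum>g\<leftarrow>gs. F g u x v y)"
  using assms by (induction gs) (simp_all add: sn_le_zero sn_le_add)

text \<open>
  The tensor on the right is \<open>(A \<otimes> 1) W (A \<otimes> 1)\<^sup>*\<close>, where \<open>A\<close> sends the \<open>j\<close>-th basis vector to \<open>\<alpha>\<^sub>j\<close>;
  the map \<open>A \<otimes> 1\<close> sends product vectors to product vectors.
\<close>

lemma sn_le_local_map:
  assumes "sn_le s d t W"
  shows "sn_le n d t (\<lambda>u x v y. \<Sum>j<s. \<Sum>l<s. \<alpha> j u * cnj (\<alpha> l v) * W j x l y)"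
proof -
  obtain gs where gs: "\<And>g. g \<in> set gs \<Longrightarrow> schmidt_le s d t g"
    and W: "\<And>u x v y. u < s \<Longrightarrow> x < d \<Longrightarrow> v < s \<Longrightarrow> y < d \<Longrightarrow> W u x v y = (\<Sum>g\<leftarrow>gs. g u x * cnj (g v y))"
    using sn_leE[OF assms] by blast
  define hs where "hs = map (\<lambda>g u x. \<Sum>j<s. \<alpha> j u * g j x) gs"
  show ?thesis
  proof (rule sn_leI[of hs])
    fix h assume "h \<in> set hs"
    then obtain g where g: "g \<in> set gs" and h: "h = (\<lambda>u x. \<Sum>j<s. \<alpha> j u * g j x)"
      by (auto simp: hs_def)
    obtain a b where ab: "\<forall>j<s. \<forall>x<d. g j x = (\<Sum>i<t. a i j * b i x)"
      using gs[OF g] by (auto simp: schmidt_le_def)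
    show "schmidt_le n d t h"
    proof (rule schmidt_leI)
      fix u x assume "x < d"
      have "h u x = (\<Sum>j<s. \<Sum>i<t. \<alpha> j u * (a i j * b i x))"
        unfolding h using ab \<open>x < d\<close> by (simp add: sum_distrib_left)
      also have "\<dots> = (\<Sum>i<t. (\<Sum>j<s. \<alpha> j u * a i j) * b i x)"
        by (subst sum.swap) (simp add: sum_distrib_left mult_ac)
      finally show "h u x = (\<Sum>i<t. (\<Sum>j<s. \<alpha> j u * a i j) * b i x)" .
    qed
  next
    fix u x v y assume "x < d" "y < d"
    have "(\<Sum>j<s. \<Sum>l<s. \<alpha> j u * cnj (\<alpha> l v) * W j x l y)
        = (\<Sum>j<s. \<Sum>l<s. \<alpha> j u * cnj (\<alpha> l v) * (\<Sum>g\<leftarrow>gs. g j x * cnj (g l y)))"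
      using W \<open>x < d\<close> \<open>y < d\<close> by simp
    also have "\<dots> = (\<Sum>g\<leftarrow>gs. (\<Sum>j<s. \<alpha> j u * g j x) * cnj (\<Sum>l<s. \<alpha> l v * g l y))"
    proof (induction gs)
      case (Cons g gs)
      have "(\<Sum>j<s. \<alpha> j u * g j x) * cnj (\<Sum>l<s. \<alpha> l v * g l y)
          = (\<Sum>j<s. \<Sum>l<s. \<alpha> j u * cnj (\<alpha> l v) * (g j x * cnj (g l y)))"
        by (simp add: sum_product mult_ac)
      then show ?case using Cons by (simp add: distrib_left sum.distrib)
    qed simp
    finally show "(\<Sum>j<s. \<Sum>l<s. \<alpha> j u * cnj (\<alpha> l v) * W j x l y) = (\<Sum>h\<leftarrow>hs. h u x * cnj (h v y))"
      by (simp add: hs_def comp_def)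
  qed
qed

text \<open>
  The product vector accounts for one term, and each of the rows \<open>k, \<dots>, s - 1\<close> for one more.
\<close>

lemma schmidt_le_extend_product:
  assumes "k \<le> s" "\<And>j x. j < k \<Longrightarrow> x < d \<Longrightarrow> g j x = a j * b x"
  shows "schmidt_le s d (Suc (s - k)) g"
proof (rule schmidt_leI)
  define \<alpha> where "\<alpha> = (\<lambda>i j. if i = 0 then (if j < k then a j else 0)
    else if j = k + (i - 1) then 1 else (0::complex))"
  define \<beta> where "\<beta> = (\<lambda>i x. if i = 0 then b x else g (k + (i - 1)) x)"
  fix j x assume jx: "j < s" "x < d"
  have "(\<Sum>i<Suc (s - k). \<alpha> i j * \<beta> i x)
      = (if j < k then a j else 0) * b x + (\<Sum>i<s - k. (if j = k + i then 1 else 0) * g (k + i) x)"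
    unfolding sum.lessThan_Suc_shift by (simp add: \<alpha>_def \<beta>_def)
  also have "\<dots> = g j x"
  proof (cases "j < k")
    case True
    then have "(\<Sum>i<s - k. (if j = k + i then 1 else 0) * g (k + i) x) = 0"
      by (intro sum.neutral) auto
    then show ?thesis using True assms(2) jx by simp
  next
    case False
    then have "(\<Sum>i<s - k. (if j = k + i then 1 else 0) * g (k + i) x)
       = (\<Sum>i<s - k. g (k + i) x * (if i = j - k then 1 else 0))"
      by (intro sum.cong) auto
    also have "\<dots> = g (k + (j - k)) x" using False jx by (intro sum_times_delta) auto
    finally show ?thesis using False by simp
  qed
  finally show "g j x = (\<Sum>i<Suc (s - k). \<alpha> i j * \<beta> i x)" ..
qed

lemma pair_index:
  assumes "u < n" "x < (d::nat)"
  shows "u * d + x < n * d" "(u * d + x) div d = u" "(u * d + x) mod d = x"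
proof -
  have "u * d + x < Suc u * d" using assms by simp
  also have "\<dots> \<le> n * d" using assms by (intro mult_le_mono1) auto
  finally show "u * d + x < n * d" .
qed (use assms in auto)

text \<open>
  In the row-major order of pairs, the pairs with first index below \<open>k\<close> are exactly the indices
  below \<open>k * d\<close>, so \<open>block_extension\<close> applies. The prolonged product vectors and the vectors
  vanishing on the block have Schmidt rank at most \<open>1 + (s - k)\<close>.
\<close>

lemma sn_le_block_extension:
  assumes "k \<le> s" and big: "sn_le s d t W" and small: "sn_le k d 1 W"
  shows "sn_le s d (Suc (s - k)) W"
proof (cases "d = 0")
  case True
  then show ?thesis by (intro sn_leI[of "[]"]) auto
next
  case False
  then have "0 < d" by simp
  define flat where "flat = (\<lambda>(g :: nat \<Rightarrow> nat \<Rightarrow> complex) a. g (a div d) (a mod d))"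
  define Y where "Y = (\<lambda>a b. W (a div d) (a mod d) (b div d) (b mod d))"
  obtain gs where "\<And>g. g \<in> set gs \<Longrightarrow> schmidt_le s d t g"
    and gs: "\<And>u x v y. u < s \<Longrightarrow> x < d \<Longrightarrow> v < s \<Longrightarrow> y < d \<Longrightarrow>
      W u x v y = (\<Sum>g\<leftarrow>gs. g u x * cnj (g v y))"
    using sn_leE[OF big] by blast
  obtain ps where ps: "\<And>p. p \<in> set ps \<Longrightarrow> schmidt_le k d 1 p"
    and Wps: "\<And>u x v y. u < k \<Longrightarrow> x < d \<Longrightarrow> v < k \<Longrightarrow> y < d \<Longrightarrow>
      W u x v y = (\<Sum>g\<leftarrow>ps. g u x * cnj (g v y))"
    using sn_leE[OF small] by blast
  have "Y a b = gram (map flat gs) a b" if "a < s * d" "b < s * d" for a b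
    using that \<open>0 < d\<close> by (simp add: Y_def flat_def gram_def comp_def gs less_mult_imp_div_less)
  then have "pos_form (s * d) Y" using pos_form_cong pos_form_gram by blast
  moreover have "k * d \<le> s * d" using \<open>k \<le> s\<close> by simp
  moreover have "Y a b = gram (map flat ps) a b" if "a < k * d" "b < k * d" for a b
    using that \<open>0 < d\<close> by (simp add: Y_def flat_def gram_def comp_def Wps less_mult_imp_div_less)
  ultimately obtain qs hs where
    qs: "\<forall>q\<in>set qs. \<exists>p\<in>set (map flat ps). \<forall>a<k * d. q a = p a"
    and hs: "\<forall>h\<in>set hs. \<forall>a<k * d. h a = 0"
    and Y: "\<forall>a<s * d. \<forall>b<s * d. Y a b = gram (qs @ hs) a b"
    using block_extension[of "s * d" Y "k * d" "map flat ps"] by blast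
  define pair where "pair = (\<lambda>(g :: nat \<Rightarrow> complex) u x. g (u * d + x))"
  show ?thesis
  proof (rule sn_leI[of "map pair (qs @ hs)"])
    fix u x v y assume "u < s" "x < d" "v < s" "y < d"
    then have "W u x v y = Y (u * d + x) (v * d + y)" by (simp add: Y_def)
    also have "\<dots> = gram (qs @ hs) (u * d + x) (v * d + y)"
      using Y pair_index(1) \<open>u < s\<close> \<open>x < d\<close> \<open>v < s\<close> \<open>y < d\<close> by blast
    finally show "W u x v y = (\<Sum>g\<leftarrow>map pair (qs @ hs). g u x * cnj (g v y))"
      by (simp add: gram_def pair_def comp_def)
  next
    fix g assume "g \<in> set (map pair (qs @ hs))"
    then consider (q) q where "q \<in> set qs" "g = pair q" | (h) h where "h \<in> set hs" "g = pair h" by auto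
    then show "schmidt_le s d (Suc (s - k)) g"
    proof cases
      case q
      then obtain p where p: "p \<in> set ps" "\<forall>a<k * d. q a = flat p a" using qs by auto
      obtain \<alpha> \<beta> where "\<forall>u<k. \<forall>x<d. p u x = (\<Sum>j<1::nat. \<alpha> j u * \<beta> j x)"
        using ps[OF p(1)] unfolding schmidt_le_def by blast
      then have "g j x = \<alpha> 0 j * \<beta> 0 x" if "j < k" "x < d" for j x
        using that p(2) pair_index[OF that] by (simp add: q pair_def flat_def)
      then show ?thesis using schmidt_le_extend_product[OF \<open>k \<le> s\<close>] by blast
    next
      case h
      then have "g j x = 0 * 0" if "j < k" "x < d" for j x
        using that hs pair_index(1)[OF that] by (simp add: pair_def)
      then show ?thesis by (rule schmidt_le_extend_product[OF \<open>k \<le> s\<close>])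
    qed
  qed
qed

section \<open>Maps acting through their Choi matrix\<close>

text \<open>
  The action of \<open>id \<otimes> \<Phi>\<close> on a tensor when \<open>J p x q y\<close> is the entry \<open>(x, y)\<close> of \<open>\<Phi>(E\<^sub>p\<^sub>q)\<close>, that is, when
  \<open>J\<close> is the Choi matrix of \<open>\<Phi>\<close>.
\<close>

definition choi_apply ::
  "nat \<Rightarrow> (nat \<Rightarrow> nat \<Rightarrow> nat \<Rightarrow> nat \<Rightarrow> complex) \<Rightarrow> (nat \<Rightarrow> nat \<Rightarrow> nat \<Rightarrow> nat \<Rightarrow> complex) \<Rightarrow>
    nat \<Rightarrow> nat \<Rightarrow> nat \<Rightarrow> nat \<Rightarrow> complex" where
  "choi_apply d J F u x v y = (\<Sum>p<d. \<Sum>q<d. F u p v q * J p x q y)"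

lemma choi_apply_sum_list:
  assumes "\<And>u x v y. u < n \<Longrightarrow> x < d \<Longrightarrow> v < n \<Longrightarrow> y < d \<Longrightarrow> F u x v y = (\<Sum>g\<leftarrow>gs. G g u x v y)"
    and "u < n" "v < n"
  shows "choi_apply d J F u x v y = (\<Sum>g\<leftarrow>gs. choi_apply d J (G g) u x v y)"
proof -
  have "choi_apply d J F u x v y = choi_apply d J (\<lambda>u x v y. \<Sum>g\<leftarrow>gs. G g u x v y) u x v y"
    using assms by (simp add: choi_apply_def)
  also have "\<dots> = (\<Sum>g\<leftarrow>gs. choi_apply d J (G g) u x v y)"
    by (induction gs) (simp_all add: choi_apply_def distrib_right sum.distrib)
  finally show ?thesis .
qed

text \<open>
  By linearity it suffices to treat rank-one tensors.
\<close>

lemma sn_le_choi_apply_pure: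
  assumes "\<And>g. schmidt_le n d s g \<Longrightarrow> sn_le n d t (choi_apply d J (\<lambda>u x v y. g u x * cnj (g v y)))"
    and "sn_le n d s F"
  shows "sn_le n d t (choi_apply d J F)"
proof -
  obtain gs where gs: "\<And>g. g \<in> set gs \<Longrightarrow> schmidt_le n d s g"
    and F: "\<And>u x v y. u < n \<Longrightarrow> x < d \<Longrightarrow> v < n \<Longrightarrow> y < d \<Longrightarrow> F u x v y = (\<Sum>g\<leftarrow>gs. g u x * cnj (g v y))"
    using sn_leE[OF assms(2)] by blast
  have "sn_le n d t (\<lambda>u x v y. \<Sum>g\<leftarrow>gs. choi_apply d J (\<lambda>u x v y. g u x * cnj (g v y)) u x v y)"
    by (intro sn_le_sum_list assms(1) gs)
  then show ?thesis
    by (rule sn_le_cong) (rule choi_apply_sum_list[where n = n, OF F])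
qed

text \<open>
  For a rank-one argument \<open>|g\<rangle>\<langle>g|\<close> the image is \<open>(A \<otimes> 1) J (A \<otimes> 1)\<^sup>*\<close> with the matrix \<open>A\<close> of \<open>g\<close>: the
  Schmidt number of the Choi matrix bounds that of every image.
\<close>

lemma sn_le_choi_apply:
  assumes "sn_le d d s J" "sn_le n d t F"
  shows "sn_le n d s (choi_apply d J F)"
proof (rule sn_le_choi_apply_pure[OF _ assms(2)])
  fix g
  show "sn_le n d s (choi_apply d J (\<lambda>u x v y. g u x * cnj (g v y)))"
    using sn_le_local_map[OF assms(1), of n "\<lambda>p u. g u p"]
    by (rule sn_le_cong) (simp add: choi_apply_def)
qed

text \<open>
  The central step: one application lowers the Schmidt number by \<open>k - 1\<close>. The hypothesis \<open>eb\<close> says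
  that the images of pure states with \<open>k\<close>-dimensional first factor are separable. For \<open>s < k\<close> the
  truncated difference makes the conclusion separability.
\<close>

lemma sn_le_choi_apply_decrease:
  assumes eb: "\<And>\<beta>. sn_le k d 1 (choi_apply d J (\<lambda>j p l q. \<beta> j p * cnj (\<beta> l q)))"
    and J: "sn_le d d t J" and F: "sn_le n d s F"
  shows "sn_le n d (Suc (s - k)) (choi_apply d J F)"
proof -
  \<comment> \<open>Padding with zero terms allows to assume \<open>s \<ge> k\<close>, as the block argument requires.\<close>
  define s' where "s' = max s k"
  have "k \<le> s'" and s': "s' - k = s - k" by (auto simp: s'_def)
  show ?thesis
  proof (rule sn_le_choi_apply_pure)
    show "sn_le n d s' F" using F by (rule sn_le_mono) (simp add: s'_def)
    fix g assume "schmidt_le n d s' g"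
    then obtain \<alpha> \<beta> where g: "\<forall>u<n. \<forall>x<d. g u x = (\<Sum>j<s'. \<alpha> j u * \<beta> j x)"
      by (auto simp: schmidt_le_def)
    define W where "W = choi_apply d J (\<lambda>j p l q. \<beta> j p * cnj (\<beta> l q))"
    have "sn_le s' d d (\<lambda>j p l q. \<beta> j p * cnj (\<beta> l q))"
      by (rule sn_leI[of "[\<beta>]"]) (simp_all add: schmidt_le_full)
    then have "sn_le s' d t W" unfolding W_def by (rule sn_le_choi_apply[OF J])
    moreover have "sn_le k d 1 W" unfolding W_def by (rule eb)
    ultimately have "sn_le s' d (Suc (s - k)) W"
      using sn_le_block_extension[OF \<open>k \<le> s'\<close>] s' by metis
    from sn_le_local_map[OF this, of n \<alpha>]
    show "sn_le n d (Suc (s - k)) (choi_apply d J (\<lambda>u x v y. g u x * cnj (g v y)))"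
    proof (rule sn_le_cong)
      fix u x v y assume "u < n" "v < n"
      have "choi_apply d J (\<lambda>u x v y. g u x * cnj (g v y)) u x v y
        = (\<Sum>p<d. \<Sum>q<d. (\<Sum>j<s'. \<alpha> j u * \<beta> j p) * cnj (\<Sum>l<s'. \<alpha> l v * \<beta> l q) * J p x q y)"
        using g \<open>u < n\<close> \<open>v < n\<close> by (simp add: choi_apply_def)
      also have "\<dots> = (\<Sum>p<d. \<Sum>q<d. \<Sum>j<s'. \<Sum>l<s'.
          \<alpha> j u * cnj (\<alpha> l v) * (\<beta> j p * cnj (\<beta> l q) * J p x q y))"
        unfolding cnj_sum sum_product unfolding sum_distrib_right complex_cnj_mult
        by (simp only: mult_ac)
      also have "\<dots> = (\<Sum>p<d. \<Sum>j<s'. \<Sum>q<d. \<Sum>l<s'.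
          \<alpha> j u * cnj (\<alpha> l v) * (\<beta> j p * cnj (\<beta> l q) * J p x q y))"
        by (rule sum.cong[OF refl], rule sum.swap)
      also have "\<dots> = (\<Sum>j<s'. \<Sum>p<d. \<Sum>q<d. \<Sum>l<s'.
          \<alpha> j u * cnj (\<alpha> l v) * (\<beta> j p * cnj (\<beta> l q) * J p x q y))"
        by (rule sum.swap)
      also have "\<dots> = (\<Sum>j<s'. \<Sum>p<d. \<Sum>l<s'. \<Sum>q<d.
          \<alpha> j u * cnj (\<alpha> l v) * (\<beta> j p * cnj (\<beta> l q) * J p x q y))"
        by (rule sum.cong[OF refl], rule sum.cong[OF refl], rule sum.swap)
      also have "\<dots> = (\<Sum>j<s'. \<Sum>l<s'. \<Sum>p<d. \<Sum>q<d.
          \<alpha> j u * cnj (\<alpha> l v) * (\<beta> j p * cnj (\<beta> l q) * J p x q y))"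
        by (rule sum.cong[OF refl], rule sum.swap)
      also have "\<dots> = (\<Sum>j<s'. \<Sum>l<s'. \<alpha> j u * cnj (\<alpha> l v) * W j x l y)"
        by (simp add: W_def choi_apply_def sum_distrib_left)
      finally show "choi_apply d J (\<lambda>u x v y. g u x * cnj (g v y)) u x v y
        = (\<Sum>j<s'. \<Sum>l<s'. \<alpha> j u * cnj (\<alpha> l v) * W j x l y)" .
    qed
  qed
qed

section \<open>Matrices as four-index tensors\<close>

definition entries :: "nat \<Rightarrow> complex mat \<Rightarrow> nat \<Rightarrow> nat \<Rightarrow> nat \<Rightarrow> nat \<Rightarrow> complex" where
  "entries d X u x v y = X $$ (u * d + x, v * d + y)"

definition choi_coeff ::
  "nat \<Rightarrow> (complex mat \<Rightarrow> complex mat) \<Rightarrow> nat \<Rightarrow> nat \<Rightarrow> nat \<Rightarrow> nat \<Rightarrow> complex" where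
  "choi_coeff d \<Phi> p x q y = \<Phi> (mat_unit d p q) $$ (x, y)"

lemma mat_linearD:
  assumes "mat_linear d \<Phi>" "A \<in> carrier_mat d d"
  shows "\<Phi> A \<in> carrier_mat d d" "\<Phi> (c \<cdot>\<^sub>m A) = c \<cdot>\<^sub>m \<Phi> A"
    "B \<in> carrier_mat d d \<Longrightarrow> \<Phi> (A + B) = \<Phi> A + \<Phi> B"
proof -
  interpret L: linear_map class_ring "module_mat TYPE(complex) d d"
    "module_mat TYPE(complex) d d" \<Phi> by (rule assms)
  show "\<Phi> A \<in> carrier_mat d d" "\<Phi> (c \<cdot>\<^sub>m A) = c \<cdot>\<^sub>m \<Phi> A"
    "B \<in> carrier_mat d d \<Longrightarrow> \<Phi> (A + B) = \<Phi> A + \<Phi> B"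
    using L.f_hom assms(2)
    by (simp_all add: LinearCombinations.module_hom_def module_mat_simps Pi_def)
qed

lemma mat_linear_comp:
  assumes "mat_linear d \<Phi>" "mat_linear d \<Psi>"
  shows "mat_linear d (\<Phi> \<circ> \<Psi>)"
proof -
  interpret L: linear_map class_ring "module_mat TYPE(complex) d d"
    "module_mat TYPE(complex) d d" \<Phi> by (rule assms)
  show ?thesis
    by unfold_locales
      (auto simp: LinearCombinations.module_hom_def module_mat_simps Pi_def mat_linearD[OF assms(1)] mat_linearD[OF assms(2)])
qed

lemma mat_linear_id:
  assumes "mat_linear d \<Phi>"
  shows "mat_linear d id"
proof -
  interpret L: linear_map class_ring "module_mat TYPE(complex) d d"
    "module_mat TYPE(complex) d d" \<Phi> by (rule assms)
  show ?thesis
    by unfold_locales (auto simp: LinearCombinations.module_hom_def)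
qed

lemma mat_linear_funpow: "mat_linear d \<Phi> \<Longrightarrow> mat_linear d (\<Phi> ^^ m)"
  by (induction m) (simp_all only: funpow.simps mat_linear_id mat_linear_comp)

lemma mat_unit_carrier: "mat_unit d p q \<in> carrier_mat d d"
  by (simp add: mat_unit_def)

lemma mat_linear_expand:
  assumes lin: "mat_linear d \<Phi>" and M: "M \<in> carrier_mat d d" and xy: "x < d" "y < d"
  shows "\<Phi> M $$ (x, y) = (\<Sum>p<d. \<Sum>q<d. M $$ (p, q) * choi_coeff d \<Phi> p x q y)"
proof -
  interpret M: abelian_group "module_mat TYPE(complex) d d" by (rule abelian_group_mat)
  define B where "B = (\<lambda>(p, q). M $$ (p, q) \<cdot>\<^sub>m mat_unit d p q)"
  have B: "B s \<in> carrier_mat d d" for s by (auto simp: B_def mat_unit_def split: prod.split)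
  have sum: "\<Phi> (mat_finsum d B S) $$ (x, y) = (\<Sum>s\<in>S. \<Phi> (B s) $$ (x, y))" if "finite S" for S
    using that
  proof (induction S rule: finite_induct)
    case empty
    have "0\<^sub>m d d = (0::complex) \<cdot>\<^sub>m 0\<^sub>m d d" by (intro eq_matI) auto
    then have "\<Phi> (0\<^sub>m d d) = 0 \<cdot>\<^sub>m \<Phi> (0\<^sub>m d d)" using mat_linearD(2)[OF lin zero_carrier_mat] by metis
    then have "\<Phi> (0\<^sub>m d d) $$ (x, y) = (0 \<cdot>\<^sub>m \<Phi> (0\<^sub>m d d)) $$ (x, y)" by metis
    also have "\<dots> = 0" using mat_linearD(1)[OF lin zero_carrier_mat] xy by simp
    finally show ?case by (simp add: module_mat_simps)
  next
    case (insert s S)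
    have car: "mat_finsum d B S \<in> carrier_mat d d" using insert B by (intro mat_finsum_carrier) auto
    have "mat_finsum d B (insert s S) = B s + mat_finsum d B S"
      using M.finsum_insert[of S s B] insert B by (auto simp: module_mat_simps)
    then have "\<Phi> (mat_finsum d B (insert s S)) = \<Phi> (B s) + \<Phi> (mat_finsum d B S)"
      using mat_linearD(3)[OF lin B car] by simp
    then show ?case using insert mat_linearD(1)[OF lin B] mat_linearD(1)[OF lin car] xy by simp
  qed
  have "M = mat_finsum d B ({..<d} \<times> {..<d})"
  proof (rule eq_matI)
    have car: "mat_finsum d B ({..<d} \<times> {..<d}) \<in> carrier_mat d d"
      using B by (intro mat_finsum_carrier) auto
    then show "dim_row M = dim_row (mat_finsum d B ({..<d} \<times> {..<d}))"
      "dim_col M = dim_col (mat_finsum d B ({..<d} \<times> {..<d}))" using M by auto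
    fix a b assume "a < dim_row (mat_finsum d B ({..<d} \<times> {..<d}))"
      "b < dim_col (mat_finsum d B ({..<d} \<times> {..<d}))"
    then have ab: "a < d" "b < d" using car by auto
    have "mat_finsum d B ({..<d} \<times> {..<d}) $$ (a, b) = (\<Sum>s\<in>{..<d} \<times> {..<d}. B s $$ (a, b))"
      using B ab by (intro mat_finsum_index) auto
    also have "\<dots> = (\<Sum>s\<in>{..<d} \<times> {..<d}. if s = (a, b) then M $$ (a, b) else 0)"
      using ab by (intro sum.cong refl) (auto simp: B_def mat_unit_def split: if_splits)
    also have "\<dots> = M $$ (a, b)" using ab by simp
    finally show "M $$ (a, b) = mat_finsum d B ({..<d} \<times> {..<d}) $$ (a, b)" ..
  qed
  then have "\<Phi> M $$ (x, y) = (\<Sum>s\<in>{..<d} \<times> {..<d}. \<Phi> (B s) $$ (x, y))"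
    using sum[of "{..<d} \<times> {..<d}"] by simp
  also have "\<dots> = (\<Sum>(p, q)\<in>{..<d} \<times> {..<d}. M $$ (p, q) * choi_coeff d \<Phi> p x q y)"
  proof (intro sum.cong refl)
    fix s assume "s \<in> {..<d} \<times> {..<d}"
    show "\<Phi> (B s) $$ (x, y) = (case s of (p, q) \<Rightarrow> M $$ (p, q) * choi_coeff d \<Phi> p x q y)"
      using xy
      by (auto simp: B_def choi_coeff_def carrier_matD[OF mat_linearD(1)[OF lin mat_unit_carrier]] mat_linearD(2)[OF lin mat_unit_carrier] split: prod.split)
  qed
  also have "\<dots> = (\<Sum>p<d. \<Sum>q<d. M $$ (p, q) * choi_coeff d \<Phi> p x q y)"
    by (simp add: sum.cartesian_product)
  finally show ?thesis .
qed

lemma mat_block_carrier: "mat_block d i j X \<in> carrier_mat d d"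
  by (simp add: mat_block_def)

lemma entries_id_tensor:
  assumes "mat_linear d \<Phi>" "u < n" "x < d" "v < n" "y < d"
  shows "entries d (id_tensor n d \<Phi> X) u x v y = choi_apply d (choi_coeff d \<Phi>) (entries d X) u x v y"
proof -
  have "entries d (id_tensor n d \<Phi> X) u x v y = \<Phi> (mat_block d u v X) $$ (x, y)"
    unfolding entries_def
    using id_tensor_index[OF assms(1) pair_index(1)[OF assms(2,3)] pair_index(1)[OF assms(4,5)]]
    by (simp only: pair_index[OF assms(2,3)] pair_index[OF assms(4,5)])
  also have "\<dots> = choi_apply d (choi_coeff d \<Phi>) (entries d X) u x v y"
    unfolding mat_linear_expand[OF assms(1) mat_block_carrier assms(3,5)]
    by (simp add: choi_apply_def mat_block_def entries_def)
  finally show ?thesis .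
qed

lemma id_tensor_carrier:
  assumes "mat_linear d \<Phi>"
  shows "id_tensor n d \<Phi> X \<in> carrier_mat (n * d) (n * d)"
  unfolding id_tensor_def
  by (intro mat_finsum_carrier)
    (auto simp: kron_def mat_unit_def carrier_matD[OF mat_linearD(1)[OF assms mat_block_carrier]])

lemma id_tensor_comp:
  assumes \<Phi>: "mat_linear d \<Phi>" and \<Psi>: "mat_linear d \<Psi>"
  shows "id_tensor n d (\<Phi> \<circ> \<Psi>) X = id_tensor n d \<Phi> (id_tensor n d \<Psi> X)"
proof (rule eq_matI)
  note comp = mat_linear_comp[OF \<Phi> \<Psi>]
  fix a b assume "a < dim_row (id_tensor n d \<Phi> (id_tensor n d \<Psi> X))"
    "b < dim_col (id_tensor n d \<Phi> (id_tensor n d \<Psi> X))"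
  then have ab: "a < n * d" "b < n * d" using id_tensor_carrier[OF \<Phi>] by (metis carrier_matD)+
  have lt: "a div d < n" "b div d < n" using ab by (auto simp: less_mult_imp_div_less)
  have "mat_block d i j (id_tensor n d \<Psi> X) = \<Psi> (mat_block d i j X)" if "i < n" "j < n" for i j
  proof (rule eq_matI)
    fix x y assume "x < dim_row (\<Psi> (mat_block d i j X))" "y < dim_col (\<Psi> (mat_block d i j X))"
    then have xy: "x < d" "y < d" using mat_linearD(1)[OF \<Psi> mat_block_carrier] by (metis carrier_matD)+
    then show "mat_block d i j (id_tensor n d \<Psi> X) $$ (x, y) = \<Psi> (mat_block d i j X) $$ (x, y)"
      using id_tensor_index[OF \<Psi> pair_index(1)[OF that(1) xy(1)] pair_index(1)[OF that(2) xy(2)]]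
      by (simp add: mat_block_def[of d i j "id_tensor n d \<Psi> X"] pair_index[OF that(1) xy(1)] pair_index[OF that(2) xy(2)])
  qed (simp_all add: mat_block_def[of d i j "id_tensor n d \<Psi> X"] carrier_matD[OF mat_linearD(1)[OF \<Psi> mat_block_carrier]])
  then show "id_tensor n d (\<Phi> \<circ> \<Psi>) X $$ (a, b) = id_tensor n d \<Phi> (id_tensor n d \<Psi> X) $$ (a, b)"
    by (simp add: id_tensor_index[OF comp ab] id_tensor_index[OF \<Phi> ab] lt)
qed (simp_all add: carrier_matD[OF id_tensor_carrier[OF \<Phi>]] carrier_matD[OF id_tensor_carrier[OF mat_linear_comp[OF \<Phi> \<Psi>]]])

lemma psd_iff_pos_form:
  "psd n A \<longleftrightarrow> A \<in> carrier_mat n n \<and> pos_form n (\<lambda>a b. A $$ (a, b))"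
proof -
  have eq: "(A *\<^sub>v v) \<bullet>c v = ip n (matvec n (\<lambda>a b. A $$ (a, b)) (\<lambda>a. v $ a)) (\<lambda>a. v $ a)"
    if "A \<in> carrier_mat n n" "v \<in> carrier_vec n" for v
    using that by (auto simp: scalar_prod_def ip_def matvec_def lessThan_atLeast0 intro!: sum.cong)
  show ?thesis
  proof
    assume A: "psd n A"
    have "0 \<le> ip n (matvec n (\<lambda>a b. A $$ (a, b)) v) v" for v
    proof -
      have "ip n (matvec n (\<lambda>a b. A $$ (a, b)) v) v
          = ip n (matvec n (\<lambda>a b. A $$ (a, b)) (\<lambda>a. vec n v $ a)) (\<lambda>a. vec n v $ a)"
        by (intro ip_cong) (simp_all add: matvec_def)
      also have "\<dots> = (A *\<^sub>v vec n v) \<bullet>c vec n v"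
        using A by (intro eq[symmetric]) (auto simp: psd_def)
      finally show ?thesis using A by (simp add: psd_def)
    qed
    then show "A \<in> carrier_mat n n \<and> pos_form n (\<lambda>a b. A $$ (a, b))"
      using A by (simp add: psd_def pos_form_def)
  next
    assume "A \<in> carrier_mat n n \<and> pos_form n (\<lambda>a b. A $$ (a, b))"
    then show "psd n A" by (simp add: psd_def pos_form_def eq)
  qed
qed

lemma psd_gram:
  assumes "psd n A"
  obtains gs where "\<And>a b. a < n \<Longrightarrow> b < n \<Longrightarrow> A $$ (a, b) = gram gs a b"
  using assms pos_form_imp_gram[of n "\<lambda>a b. A $$ (a, b)"] unfolding psd_iff_pos_form by blast

lemma psd_of_gram:
  assumes "A \<in> carrier_mat n n" "\<And>a b. a < n \<Longrightarrow> b < n \<Longrightarrow> A $$ (a, b) = gram gs a b"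
  shows "psd n A"
  unfolding psd_iff_pos_form
  using assms pos_form_gram[of n gs] pos_form_cong[of n "\<lambda>a b. A $$ (a, b)" "gram gs"] by blast

text \<open>
  No vector in \<open>C\<^sup>n \<otimes> C\<^sup>d\<close> has Schmidt rank above \<open>d\<close>, so any Gram vectors will do.
\<close>

lemma psd_imp_sn_le:
  assumes "psd (n * d) X"
  shows "sn_le n d d (entries d X)"
proof -
  obtain gs where gs: "\<And>a b. a < n * d \<Longrightarrow> b < n * d \<Longrightarrow> X $$ (a, b) = gram gs a b"
    using psd_gram[OF assms] by blast
  show ?thesis
    by (rule sn_leI[of "map (\<lambda>g u x. g (u * d + x)) gs"])
      (simp_all add: schmidt_le_full entries_def gs pair_index(1) gram_def comp_def)
qed

lemma kron_entries:
  assumes "A \<in> carrier_mat n n" "B \<in> carrier_mat d d" "u < n" "x < d" "v < n" "y < d"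
  shows "entries d (kron A B) u x v y = A $$ (u, v) * B $$ (x, y)"
  using assms pair_index[OF assms(3,4)] pair_index[OF assms(5,6)]
  by (simp add: entries_def kron_def)

lemma kron_carrier:
  "A \<in> carrier_mat n n \<Longrightarrow> B \<in> carrier_mat d d \<Longrightarrow> kron A B \<in> carrier_mat (n * d) (n * d)"
  by (auto simp: kron_def)

lemma sn_le_sum:
  assumes "\<And>i. i < r \<Longrightarrow> sn_le n d s (F i)"
  shows "sn_le n d s (\<lambda>u x v y. \<Sum>i<(r::nat). F i u x v y)"
  using assms by (induction r) (simp_all add: sn_le_zero sn_le_add)

text \<open>
  Products of Gram vectors of the two factors are Gram vectors of the Kronecker product.
\<close>

lemma sn_le_kron:
  assumes "psd n A" "psd d B"
  shows "sn_le n d 1 (entries d (kron A B))"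
proof -
  obtain gs where gs: "\<And>a b. a < n \<Longrightarrow> b < n \<Longrightarrow> A $$ (a, b) = gram gs a b"
    using psd_gram[OF assms(1)] by blast
  obtain hs where hs: "\<And>a b. a < d \<Longrightarrow> b < d \<Longrightarrow> B $$ (a, b) = gram hs a b"
    using psd_gram[OF assms(2)] by blast
  have "sn_le n d 1 (\<lambda>u x v y. \<Sum>g\<leftarrow>gs. \<Sum>h\<leftarrow>hs. (g u * h x) * cnj (g v * h y))"
  proof (intro sn_le_sum_list)
    fix g h :: "nat \<Rightarrow> complex"
    have "schmidt_le n d 1 (\<lambda>u x. g u * h x)"
      by (rule schmidt_leI[where \<alpha> = "\<lambda>_. g" and \<beta> = "\<lambda>_. h"]) simp
    then show "sn_le n d 1 (\<lambda>u x v y. (g u * h x) * cnj (g v * h y))"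
      by (intro sn_leI[of "[\<lambda>u x. g u * h x]"]) auto
  qed
  then show ?thesis
  proof (rule sn_le_cong)
    fix u x v y assume *: "u < n" "x < d" "v < n" "y < d"
    have "entries d (kron A B) u x v y = gram gs u v * gram hs x y"
      using kron_entries[OF _ _ *, of A B] assms * by (simp add: psd_def gs hs)
    also have "\<dots> = (\<Sum>g\<leftarrow>gs. (g u * cnj (g v)) * gram hs x y)"
      by (simp add: gram_def[of gs] sum_list_mult_const)
    also have "\<dots> = (\<Sum>g\<leftarrow>gs. \<Sum>h\<leftarrow>hs. (g u * h x) * cnj (g v * h y))"
      unfolding gram_def sum_list_const_mult[symmetric] by (simp add: mult_ac)
    finally show "entries d (kron A B) u x v y = (\<Sum>g\<leftarrow>gs. \<Sum>h\<leftarrow>hs. (g u * h x) * cnj (g v * h y))" .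
  qed
qed

lemma separable_imp_sn_le:
  assumes "separable n d X"
  shows "sn_le n d 1 (entries d X)"
proof -
  obtain r :: nat and A B where AB: "\<And>i. i < r \<Longrightarrow> psd n (A i)" "\<And>i. i < r \<Longrightarrow> psd d (B i)"
    and X: "X = mat_finsum (n * d) (\<lambda>i. kron (A i) (B i)) {..<r}"
    using assms unfolding separable_def by blast
  have "sn_le n d 1 (\<lambda>u x v y. \<Sum>i<r. entries d (kron (A i) (B i)) u x v y)"
    using AB by (intro sn_le_sum sn_le_kron)
  then show ?thesis
  proof (rule sn_le_cong)
    fix u x v y assume *: "u < n" "x < d" "v < n" "y < d"
    show "entries d X u x v y = (\<Sum>i<r. entries d (kron (A i) (B i)) u x v y)"
      unfolding entries_def X using AB pair_index(1) *
      by (intro mat_finsum_index) (auto simp: psd_def intro: kron_carrier)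
  qed
qed

lemma ketbra_psd: "v \<in> carrier_vec n \<Longrightarrow> psd n (ketbra v)"
  by (rule psd_of_gram[of _ _ "[\<lambda>a. v $ a]"]) (auto simp: ketbra_def)

lemma sn_le_imp_separable:
  assumes X: "X \<in> carrier_mat (n * d) (n * d)" and "sn_le n d 1 (entries d X)"
  shows "separable n d X"
proof -
  obtain gs where gs: "\<And>g. g \<in> set gs \<Longrightarrow> schmidt_le n d 1 g"
    and F: "\<And>u x v y. u < n \<Longrightarrow> x < d \<Longrightarrow> v < n \<Longrightarrow> y < d \<Longrightarrow>
      entries d X u x v y = (\<Sum>g\<leftarrow>gs. g u x * cnj (g v y))"
    using sn_leE[OF assms(2)] by blast
  have "\<exists>\<alpha> \<beta>. \<forall>u<n. \<forall>x<d. g u x = \<alpha> u * \<beta> x" if g: "g \<in> set gs" for g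
  proof -
    obtain \<alpha> \<beta> where "\<forall>u<n. \<forall>x<d. g u x = (\<Sum>j<1::nat. \<alpha> j u * \<beta> j x)"
      using gs[OF g] unfolding schmidt_le_def by blast
    then show ?thesis by (intro exI[of _ "\<alpha> 0"] exI[of _ "\<beta> 0"]) simp
  qed
  then have "\<forall>g\<in>set gs. \<exists>\<alpha> \<beta>. \<forall>u<n. \<forall>x<d. g u x = \<alpha> u * \<beta> x" by blast
  then obtain \<alpha> \<beta> where ab: "\<And>g u x. g \<in> set gs \<Longrightarrow> u < n \<Longrightarrow> x < d \<Longrightarrow> g u x = \<alpha> g u * \<beta> g x"
    by metis
  define r where "r = length gs"
  define A where "A i = ketbra (vec n (\<alpha> (gs ! i)))" for i
  define B where "B i = ketbra (vec d (\<beta> (gs ! i)))" for i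
  have A: "psd n (A i)" and B: "psd d (B i)" for i
    by (auto simp: A_def B_def intro: ketbra_psd)
  have kc: "kron (A i) (B i) \<in> carrier_mat (n * d) (n * d)" for i
    using A B by (auto simp: psd_def intro: kron_carrier)
  have div: "a div d < n" "a mod d < d" "a div d * d + a mod d = a" if "a < n * d" for a
    using that by (auto simp: less_mult_imp_div_less intro!: mod_less_divisor gr0I)
  have fc: "mat_finsum (n * d) (\<lambda>i. kron (A i) (B i)) {..<r} \<in> carrier_mat (n * d) (n * d)"
    using kc by (intro mat_finsum_carrier) auto
  have "X = mat_finsum (n * d) (\<lambda>i. kron (A i) (B i)) {..<r}"
  proof (rule eq_matI)
    fix a b assume "a < dim_row (mat_finsum (n * d) (\<lambda>i. kron (A i) (B i)) {..<r})"
      "b < dim_col (mat_finsum (n * d) (\<lambda>i. kron (A i) (B i)) {..<r})"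
    then have ab': "a < n * d" "b < n * d" using fc by auto
    have "X $$ (a, b) = entries d X (a div d) (a mod d) (b div d) (b mod d)"
      by (simp only: entries_def div[OF ab'(1)] div[OF ab'(2)])
    also have "\<dots> = (\<Sum>g\<leftarrow>gs. g (a div d) (a mod d) * cnj (g (b div d) (b mod d)))"
      using F div ab' by blast
    also have "\<dots> = (\<Sum>i<r. (gs ! i) (a div d) (a mod d) * cnj ((gs ! i) (b div d) (b mod d)))"
      by (simp add: sum_list_sum_nth r_def lessThan_atLeast0)
    also have "\<dots> = (\<Sum>i<r. kron (A i) (B i) $$ (a, b))"
    proof (intro sum.cong refl)
      fix i assume "i \<in> {..<r}"
      then have i: "gs ! i \<in> set gs" by (simp add: r_def)
      show "(gs ! i) (a div d) (a mod d) * cnj ((gs ! i) (b div d) (b mod d)) = kron (A i) (B i) $$ (a, b)"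
        using div[OF ab'(1)] div[OF ab'(2)] ab'
        by (simp add: ab[OF i] kron_def A_def B_def ketbra_def)
    qed
    also have "\<dots> = mat_finsum (n * d) (\<lambda>i. kron (A i) (B i)) {..<r} $$ (a, b)"
      using kc ab' by (intro mat_finsum_index[symmetric]) auto
    finally show "X $$ (a, b) = mat_finsum (n * d) (\<lambda>i. kron (A i) (B i)) {..<r} $$ (a, b)" .
  qed (use X fc in auto)
  moreover have "psd (n * d) X"
  proof (rule psd_of_gram[OF X])
    fix a b assume ab': "a < n * d" "b < n * d"
    have "X $$ (a, b) = entries d X (a div d) (a mod d) (b div d) (b mod d)"
      by (simp only: entries_def div[OF ab'(1)] div[OF ab'(2)])
    also have "\<dots> = (\<Sum>g\<leftarrow>gs. g (a div d) (a mod d) * cnj (g (b div d) (b mod d)))"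
      using F div ab' by blast
    finally show "X $$ (a, b) = gram (map (\<lambda>g a. g (a div d) (a mod d)) gs) a b"
      by (simp add: gram_def comp_def)
  qed
  ultimately show ?thesis unfolding separable_def using A B by blast
qed

text \<open>
  The defining property, applied to the pure state of the vector with components \<open>\<beta> j p\<close>.
\<close>

lemma k_entanglement_breaking_pure:
  assumes "k_entanglement_breaking k d \<Phi>"
  shows "sn_le k d 1 (choi_apply d (choi_coeff d \<Phi>) (\<lambda>j p l q. \<beta> j p * cnj (\<beta> l q)))"
proof -
  have lin: "mat_linear d \<Phi>"
    using assms by (simp add: k_entanglement_breaking_def k_positive_def)
  define b where "b = vec (k * d) (\<lambda>a. \<beta> (a div d) (a mod d))"
  have "psd (k * d) (ketbra b)" by (intro ketbra_psd) (simp add: b_def)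
  then have "sn_le k d 1 (entries d (id_tensor k d \<Phi> (ketbra b)))"
    using assms by (intro separable_imp_sn_le) (simp add: k_entanglement_breaking_def)
  then show ?thesis
  proof (rule sn_le_cong)
    fix u x v y assume *: "u < k" "x < d" "v < k" "y < d"
    have "entries d (ketbra b) u p v q = \<beta> u p * cnj (\<beta> v q)" if "p < d" "q < d" for p q
      using pair_index[OF *(1) that(1)] pair_index[OF *(3) that(2)]
      by (simp add: entries_def ketbra_def b_def)
    then show "choi_apply d (choi_coeff d \<Phi>) (\<lambda>j p l q. \<beta> j p * cnj (\<beta> l q)) u x v y
        = entries d (id_tensor k d \<Phi> (ketbra b)) u x v y"
      by (simp add: entries_id_tensor[OF lin *] choi_apply_def)
  qed
qed

text \<open>
  The Choi matrix is the image of the unnormalised maximally entangled state \<open>\<Sum>\<^sub>i e\<^sub>i \<otimes> e\<^sub>i\<close>; this makes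
  it positive when \<open>\<Phi>\<close> is \<open>d\<close>-positive.
\<close>

lemma choi_eq_id_tensor:
  assumes "mat_linear d \<Phi>"
  shows "choi d \<Phi> = id_tensor d d \<Phi> (ketbra (vec (d * d) (\<lambda>a. if a div d = a mod d then 1 else 0)))"
    (is "_ = id_tensor d d \<Phi> (ketbra ?\<Omega>)")
proof -
  interpret M: abelian_group "module_mat TYPE(complex) (d * d) (d * d)" by (rule abelian_group_mat)
  have *: "mat_block d i j (ketbra ?\<Omega>) = mat_unit d i j" if "i < d" "j < d" for i j
    by (rule eq_matI)
      (use that in \<open>auto simp: mat_block_def mat_unit_def ketbra_def pair_index(1)\<close>)
  show ?thesis
    unfolding choi_def id_tensor_def
    by (rule M.finsum_cong')
      (auto simp: * module_mat_simps intro!: kron_carrier mat_unit_carrier mat_linearD(1)[OF assms])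
qed

lemma entries_choi:
  assumes "mat_linear d \<Phi>" "p < d" "x < d" "q < d" "y < d"
  shows "entries d (choi d \<Phi>) p x q y = choi_coeff d \<Phi> p x q y"
proof -
  have kc: "kron (mat_unit d i j) (\<Phi> (mat_unit d i j)) \<in> carrier_mat (d * d) (d * d)" for i j
    by (intro kron_carrier mat_unit_carrier mat_linearD(1)[OF assms(1)])
  have "choi d \<Phi> $$ (p * d + x, q * d + y) =
    (\<Sum>s\<in>{..<d} \<times> {..<d}. (case s of (i, j) \<Rightarrow> kron (mat_unit d i j) (\<Phi> (mat_unit d i j))) $$ (p * d + x, q * d + y))"
    unfolding choi_def using kc
    by (intro mat_finsum_index pair_index(1) assms) auto
  also have "\<dots> = (\<Sum>s\<in>{..<d} \<times> {..<d}. if s = (p, q) then choi_coeff d \<Phi> p x q y else 0)"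
  proof (intro sum.cong refl)
    fix s assume "s \<in> {..<d} \<times> {..<d}"
    then obtain i j where s: "s = (i, j)" "i < d" "j < d" by auto
    have "kron (mat_unit d i j) (\<Phi> (mat_unit d i j)) $$ (p * d + x, q * d + y)
       = mat_unit d i j $$ (p, q) * \<Phi> (mat_unit d i j) $$ (x, y)"
      using kron_entries[OF mat_unit_carrier mat_linearD(1)[OF assms(1) mat_unit_carrier] assms(2-5)]
      unfolding entries_def .
    then show "(case s of (i, j) \<Rightarrow> kron (mat_unit d i j) (\<Phi> (mat_unit d i j))) $$ (p * d + x, q * d + y)
      = (if s = (p, q) then choi_coeff d \<Phi> p x q y else 0)"
      using assms by (auto simp: s mat_unit_def choi_coeff_def)
  qed
  also have "\<dots> = choi_coeff d \<Phi> p x q y" using assms by simp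
  finally show ?thesis by (simp add: entries_def)
qed

lemma choi_psd:
  assumes "completely_positive d \<Phi>" "0 < d"
  shows "psd (d * d) (choi d \<Phi>)"
proof -
  have "k_positive d d \<Phi>" using assms by (simp add: completely_positive_def)
  then have "mat_linear d \<Phi>" and "positive_map (d * d) (id_tensor d d \<Phi>)"
    by (simp_all add: k_positive_def)
  then show ?thesis unfolding choi_eq_id_tensor[OF \<open>mat_linear d \<Phi>\<close>]
    by (simp add: positive_map_def ketbra_psd)
qed

section \<open>The Schmidt decomposition\<close>

text \<open>
  If every \<open>u\<^sub>j\<close> with \<open>j \<in> S\<close> lies in the span of the \<open>u'\<^sub>l\<close> with \<open>l \<in> S'\<close>, then
  \<open>card S = \<Sum>\<^sub>j \<Sum>\<^sub>l |\<langle>u'\<^sub>l, u\<^sub>j\<rangle>|\<^sup>2\<close>, and by Bessel's inequality the sum over \<open>j\<close> is at most 1 for every \<open>l\<close>.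
\<close>

lemma orthonormal_span_card:
  assumes u: "orthonormal m r u" and u': "orthonormal m r' u'" and "S \<subseteq> {..<r}" and "S' \<subseteq> {..<r'}"
    and span: "\<And>j i. j \<in> S \<Longrightarrow> i < m \<Longrightarrow> u j i = (\<Sum>l\<in>S'. e j l * u' l i)"
  shows "card S \<le> card S'"
proof -
  have fin: "finite S" "finite S'" using assms(3,4) finite_subset by blast+
  have coeff: "ip m (u j) (u' l) = e j l" if "j \<in> S" "l \<in> S'" for j l
  proof -
    have "ip m (u j) (u' l) = ip m (\<lambda>i. \<Sum>l\<in>S'. e j l * u' l i) (u' l)"
      using span that by (intro ip_cong) auto
    also have "\<dots> = (\<Sum>h\<in>S'. e j h * (if h = l then 1 else 0))"
      unfolding ip_sum_left ip_scale_left
      by (intro sum.cong refl) (use that assms(4) in \<open>simp add: orthonormalD[OF u'] subset_eq\<close>)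
    also have "\<dots> = (\<Sum>h\<in>S'. if h = l then e j h else 0)" by (intro sum.cong) auto
    also have "\<dots> = e j l" using fin that by simp
    finally show ?thesis .
  qed
  have unit: "(\<Sum>l\<in>S'. (cmod (ip m (u' l) (u j)))\<^sup>2) = 1" if "j \<in> S" for j
  proof -
    have "1 = ip m (u j) (u j)" using that assms(3) by (auto simp: orthonormalD[OF u])
    also have "\<dots> = ip m (\<lambda>i. \<Sum>l\<in>S'. e j l * u' l i) (u j)"
      using span that by (intro ip_cong) auto
    also have "\<dots> = (\<Sum>l\<in>S'. e j l * ip m (u' l) (u j))"
      unfolding ip_sum_left ip_scale_left ..
    also have "\<dots> = (\<Sum>l\<in>S'. complex_of_real ((cmod (ip m (u' l) (u j)))\<^sup>2))"
    proof (intro sum.cong refl)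
      fix l assume "l \<in> S'"
      then have "e j l = cnj (ip m (u' l) (u j))" using coeff[OF that] by (simp add: ip_cnj)
      then show "e j l * ip m (u' l) (u j) = complex_of_real ((cmod (ip m (u' l) (u j)))\<^sup>2)"
        by (simp only: complex_norm_square mult.commute)
    qed
    finally have "complex_of_real (\<Sum>l\<in>S'. (cmod (ip m (u' l) (u j)))\<^sup>2) = complex_of_real 1" by simp
    then show ?thesis unfolding of_real_eq_iff .
  qed
  have "real (card S) = (\<Sum>j\<in>S. \<Sum>l\<in>S'. (cmod (ip m (u' l) (u j)))\<^sup>2)" using unit by simp
  also have "\<dots> = (\<Sum>l\<in>S'. \<Sum>j\<in>S. (cmod (ip m (u' l) (u j)))\<^sup>2)" by (rule sum.swap)
  also have "\<dots> \<le> (\<Sum>l\<in>S'. 1)"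
  proof (rule sum_mono)
    fix l assume "l \<in> S'"
    have "(\<Sum>j\<in>S. (cmod (ip m (u' l) (u j)))\<^sup>2) \<le> (\<Sum>j<r. (cmod (ip m (u' l) (u j)))\<^sup>2)"
      using assms(3) by (intro sum_mono2) auto
    also have "\<dots> \<le> (\<Sum>a<m. (cmod (u' l a))\<^sup>2)" by (rule bessel[OF u])
    also have "\<dots> = 1"
    proof -
      have "complex_of_real (\<Sum>a<m. (cmod (u' l a))\<^sup>2) = complex_of_real 1"
        unfolding ip_self[symmetric] using \<open>l \<in> S'\<close> assms(4) by (auto simp: orthonormalD[OF u'])
      then show ?thesis unfolding of_real_eq_iff .
    qed
    finally show "(\<Sum>j\<in>S. (cmod (ip m (u' l) (u j)))\<^sup>2) \<le> 1" .
  qed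
  finally show ?thesis by simp
qed

text \<open>
  Uniqueness of the Schmidt rank, in the form of one inequality: contracting the second index
  with \<open>v\<^sub>j\<close> expresses \<open>c\<^sub>j u\<^sub>j\<close> through the \<open>u'\<^sub>l\<close> with \<open>c'\<^sub>l \<noteq> 0\<close>.
\<close>

lemma schmidt_coefficients_card_le:
  assumes u: "orthonormal m r u" "orthonormal m r' u'" and v: "orthonormal n r v"
    and eq: "\<And>i x. i < m \<Longrightarrow> x < n \<Longrightarrow>
      (\<Sum>j<r. c j * (u j i * v j x)) = (\<Sum>j<r'. c' j * (u' j i * v' j x))"
  shows "card {j. j < r \<and> c j \<noteq> 0} \<le> card {j. j < r' \<and> c' j \<noteq> 0}"
proof (rule orthonormal_span_card[OF u, where e = "\<lambda>j l. c' l / c j * ip n (v' l) (v j)"])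
  fix j i assume "j \<in> {j. j < r \<and> c j \<noteq> 0}" "i < m"
  then have j: "j < r" "c j \<noteq> 0" by auto
  have "c j * u j i = ip n (\<lambda>x. \<Sum>h<r. (c h * u h i) * v h x) (v j)"
    using ip_orthonormal_sum[OF v j(1), of "\<lambda>h. c h * u h i"] by simp
  also have "\<dots> = ip n (\<lambda>x. \<Sum>l<r'. (c' l * u' l i) * v' l x) (v j)"
    using eq[OF \<open>i < m\<close>] by (intro ip_cong) (simp_all add: mult.assoc)
  also have "\<dots> = (\<Sum>l<r'. c' l * u' l i * ip n (v' l) (v j))"
    unfolding ip_sum_left ip_scale_left ..
  also have "\<dots> = (\<Sum>l | l < r' \<and> c' l \<noteq> 0. c' l * u' l i * ip n (v' l) (v j))"
    by (rule sum.mono_neutral_right) auto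
  finally have "u j i = (\<Sum>l | l < r' \<and> c' l \<noteq> 0. c' l * u' l i * ip n (v' l) (v j)) / c j"
    using j by (simp add: field_simps)
  then show "u j i = (\<Sum>l | l < r' \<and> c' l \<noteq> 0. c' l / c j * ip n (v' l) (v j) * u' l i)"
    by (simp add: sum_divide_distrib mult_ac)
qed auto

text \<open>
  Let \<open>G\<close> be the matrix with entries \<open>g i x\<close>. In an orthonormal eigenbasis \<open>u\<^sub>i\<close> of \<open>H = G G\<^sup>*\<close>, the
  vectors \<open>w\<^sub>i\<close> with components \<open>\<Sum>\<^sub>p cnj (u\<^sub>i p) * g p x\<close> satisfy \<open>g = \<Sum>\<^sub>i u\<^sub>i \<otimes> w\<^sub>i\<close> and are orthogonal, with
  squared norm equal to the eigenvalue of \<open>u\<^sub>i\<close>. Normalising the nonzero \<open>w\<^sub>i\<close> gives the second family.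
\<close>

lemma schmidt_decomposition_exists:
  fixes g :: "nat \<Rightarrow> nat \<Rightarrow> complex"
  shows "\<exists>r (c :: nat \<Rightarrow> real) u v. orthonormal m r u \<and> orthonormal n r v \<and> (\<forall>j<r. 0 \<le> c j) \<and>
    (\<forall>i<m. \<forall>x<n. g i x = (\<Sum>j<r. complex_of_real (c j) * (u j i * v j x)))"
proof -
  define H where "H = (\<lambda>p q. ip n (g p) (g q))"
  obtain u lam where u: "orthonormal m m u"
    and lam: "\<And>i a. i < m \<Longrightarrow> a < m \<Longrightarrow> matvec m H (u i) a = complex_of_real (lam i) * u i a"
    and "\<And>a b. a < m \<Longrightarrow> b < m \<Longrightarrow> H a b = (\<Sum>i<m. lam i * (u i a * cnj (u i b)))"
  proof (rule spectral[of m H])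
    show "H b a = cnj (H a b)" for a b by (simp only: H_def ip_cnj)
  qed blast
  define w where "w = (\<lambda>i x. \<Sum>p<m. cnj (u i p) * g p x)"
  have w: "ip n (w i) (w j) = (if i = j then complex_of_real (lam j) else 0)" if "i < m" "j < m" for i j
  proof -
    have "ip n (w i) (w j) = (\<Sum>p<m. \<Sum>q<m. u j q * (cnj (u i p) * H p q))"
      unfolding w_def ip_sum_left ip_sum_right ip_scale_left ip_scale_right H_def
      by (simp add: mult_ac sum_distrib_left)
    also have "\<dots> = ip m (matvec m H (u j)) (u i)"
      by (simp add: ip_def matvec_def sum_distrib_left mult_ac)
    also have "\<dots> = ip m (\<lambda>a. complex_of_real (lam j) * u j a) (u i)"
      using lam that by (intro ip_cong) auto
    also have "\<dots> = (if i = j then complex_of_real (lam j) else 0)"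
      using that by (simp add: ip_scale_left orthonormalD[OF u])
    finally show ?thesis .
  qed
  have nonneg: "0 \<le> lam i" if "i < m" for i
  proof -
    have "complex_of_real (lam i) = complex_of_real (\<Sum>x<n. (cmod (w i x))\<^sup>2)"
      using w[OF that that] unfolding ip_self by simp
    then have "lam i = (\<Sum>x<n. (cmod (w i x))\<^sup>2)" unfolding of_real_eq_iff .
    then show ?thesis by (simp add: sum_nonneg)
  qed
  have null: "w i x = 0" if "i < m" "lam i = 0" "x < n" for i x
    using w[OF that(1) that(1)] that ip_self_eq_0_iff[of n "w i"] by simp
  have g: "g i x = (\<Sum>j<m. u j i * w j x)" if "i < m" for i x
  proof -
    have "(\<Sum>j<m. u j i * w j x) = (\<Sum>j<m. \<Sum>p<m. g p x * (u j i * cnj (u j p)))"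
      by (simp add: w_def sum_distrib_left mult_ac)
    also have "\<dots> = (\<Sum>p<m. g p x * (\<Sum>j<m. u j i * cnj (u j p)))"
      unfolding sum_distrib_left by (rule sum.swap)
    also have "\<dots> = (\<Sum>p<m. g p x * (if i = p then 1 else 0))"
      by (intro sum.cong refl) (simp only: orthonormal_complete[OF u that] lessThan_iff)
    also have "\<dots> = g i x" using that by (simp add: sum_times_delta)
    finally show ?thesis ..
  qed
  define S where "S = {i. i < m \<and> lam i \<noteq> 0}"
  have "finite S" by (simp add: S_def)
  then obtain b where b: "bij_betw b {..<card S} S"
    using ex_bij_betw_nat_finite by (metis lessThan_atLeast0)
  have bS: "b j < m" "0 < lam (b j)" if "j < card S" for j
  proof -
    have "b j \<in> S" using b that by (auto simp: bij_betw_def)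
    then show "b j < m" "0 < lam (b j)" using nonneg[of "b j"] by (auto simp: S_def)
  qed
  have inj: "b i = b j \<longleftrightarrow> i = j" if "i < card S" "j < card S" for i j
    using b that by (auto simp: bij_betw_def inj_on_def)
  define c where "c = (\<lambda>j. sqrt (lam (b j)))"
  define v where "v = (\<lambda>j x. complex_of_real (1 / c j) * w (b j) x)"
  have "orthonormal m (card S) (\<lambda>j. u (b j))"
    using bS inj by (simp add: orthonormal_def orthonormalD[OF u])
  moreover have "orthonormal n (card S) v"
    unfolding orthonormal_def
  proof (intro allI impI)
    fix i j assume ij: "i < card S" "j < card S"
    have "ip n (v i) (v j) = complex_of_real (1 / c i) * (complex_of_real (1 / c j) * ip n (w (b i)) (w (b j)))"
      unfolding v_def ip_scale_left ip_scale_right complex_cnj_complex_of_real ..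
    also have "\<dots> = (if i = j then complex_of_real (1 / c j * (1 / c j * lam (b j))) else 0)"
      using w[OF bS(1)[OF ij(1)] bS(1)[OF ij(2)]] inj[OF ij] by simp
    also have "1 / c j * (1 / c j * lam (b j)) = 1"
      using bS(2)[OF ij(2)] by (simp add: c_def field_simps)
    finally show "ip n (v i) (v j) = (if i = j then 1 else 0)" by simp
  qed
  moreover have "\<forall>j<card S. 0 \<le> c j" using bS(2) by (simp add: c_def less_imp_le)
  moreover have "g i x = (\<Sum>j<card S. complex_of_real (c j) * (u (b j) i * v j x))" if "i < m" "x < n" for i x
  proof -
    have "g i x = (\<Sum>j\<in>S. u j i * w j x)"
      unfolding g[OF that(1)] by (rule sum.mono_neutral_right) (auto simp: S_def null that)
    also have "\<dots> = (\<Sum>j<card S. u (b j) i * w (b j) x)"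
      by (rule sum.reindex_bij_betw[OF b, symmetric])
    also have "\<dots> = (\<Sum>j<card S. complex_of_real (c j) * (u (b j) i * v j x))"
    proof (intro sum.cong refl)
      fix j assume "j \<in> {..<card S}"
      then have "c j \<noteq> 0" using bS(2)[of j] by (simp add: c_def)
      then show "u (b j) i * w (b j) x = complex_of_real (c j) * (u (b j) i * v j x)"
        by (simp add: v_def)
    qed
    finally show ?thesis .
  qed
  ultimately show ?thesis
    by (intro exI[of _ "card S"] exI[of _ c] exI[of _ "\<lambda>j. u (b j)"] exI[of _ v]) simp
qed

lemma orthonormal_family_iff:
  "orthonormal_family n r u \<longleftrightarrow> (\<forall>i<r. u i \<in> carrier_vec n) \<and> orthonormal n r (\<lambda>i a. u i $ a)"
proof -
  have "u i \<bullet>c u j = ip n (\<lambda>a. u i $ a) (\<lambda>a. u j $ a)" if "u j \<in> carrier_vec n" for i j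
    using that by (auto simp: scalar_prod_def ip_def lessThan_atLeast0)
  then show ?thesis unfolding orthonormal_family_def orthonormal_def by auto
qed

lemma schmidt_decomposition_iff:
  assumes \<xi>: "\<xi> \<in> carrier_vec (m * n)"
  shows "schmidt_decomposition m n \<xi> r c u v \<longleftrightarrow>
    orthonormal_family m r u \<and> orthonormal_family n r v \<and> (\<forall>i<r. 0 \<le> c i) \<and>
    (\<forall>i<m. \<forall>x<n. \<xi> $ (i * n + x) = (\<Sum>j<r. complex_of_real (c j) * (u j $ i * v j $ x)))"
proof (cases "orthonormal_family m r u \<and> orthonormal_family n r v")
  case True
  let ?t = "\<lambda>j. complex_of_real (c j) \<cdot>\<^sub>v kron_vec (u j) (v j)"
  let ?s = "finsum_vec TYPE(complex) (m * n) ?t {..<r}"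
  have car: "u j \<in> carrier_vec m" "v j \<in> carrier_vec n" if "j < r" for j
    using True that by (auto simp: orthonormal_family_def)
  have t: "?t \<in> {..<r} \<rightarrow> carrier_vec (m * n)"
  proof
    fix j assume "j \<in> {..<r}"
    then have "dim_vec (u j) = m" "dim_vec (v j) = n" using car[of j] by auto
    then show "?t j \<in> carrier_vec (m * n)" by (simp add: kron_vec_def)
  qed
  have s: "?s \<in> carrier_vec (m * n)" by (rule finsum_vec_closed[OF t])
  have idx: "?s $ (i * n + x) = (\<Sum>j<r. complex_of_real (c j) * (u j $ i * v j $ x))" if "i < m" "x < n" for i x
  proof -
    have "?s $ (i * n + x) = (\<Sum>j<r. ?t j $ (i * n + x))"
      by (rule index_finsum_vec[OF _ pair_index(1)[OF that] t]) simp
    also have "\<dots> = (\<Sum>j<r. complex_of_real (c j) * (u j $ i * v j $ x))"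
    proof (intro sum.cong refl)
      fix j assume "j \<in> {..<r}"
      then have "dim_vec (u j) = m" "dim_vec (v j) = n" using car[of j] by auto
      then show "?t j $ (i * n + x) = complex_of_real (c j) * (u j $ i * v j $ x)"
        using pair_index[OF that] by (simp add: kron_vec_def)
    qed
    finally show ?thesis .
  qed
  have "\<xi> = ?s \<longleftrightarrow> (\<forall>i<m. \<forall>x<n. \<xi> $ (i * n + x) = ?s $ (i * n + x))"
  proof
    assume *: "\<forall>i<m. \<forall>x<n. \<xi> $ (i * n + x) = ?s $ (i * n + x)"
    show "\<xi> = ?s"
    proof (rule eq_vecI)
      fix a assume "a < dim_vec ?s"
      then have "a < m * n" using s by auto
      then have "a div n < m" "a mod n < n"
        by (auto simp: less_mult_imp_div_less intro!: mod_less_divisor gr0I)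
      then have "\<xi> $ (a div n * n + a mod n) = ?s $ (a div n * n + a mod n)" using * by blast
      then show "\<xi> $ a = ?s $ a" by simp
    qed (use s \<xi> in auto)
  qed simp
  then show ?thesis using True idx by (auto simp: schmidt_decomposition_def)
next
  case False
  then show ?thesis by (auto simp: schmidt_decomposition_def)
qed

text \<open>
  Existence, together with the uniqueness of the count, justifies the definite description in the definition of the Schmidt rank.
\<close>

lemma schmidt_rank_attained:
  assumes \<xi>: "\<xi> \<in> carrier_vec (m * n)"
  shows "\<exists>r c u v. schmidt_decomposition m n \<xi> r c u v \<and> schmidt_rank m n \<xi> = card {i. i < r \<and> c i \<noteq> 0}"
proof -
  let ?P = "\<lambda>s. \<exists>r c u v. schmidt_decomposition m n \<xi> r c u v \<and> s = card {i. i < r \<and> c i \<noteq> 0}"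
  obtain r u v and c :: "nat \<Rightarrow> real" where *: "orthonormal m r u" "orthonormal n r v" "\<forall>j<r. 0 \<le> c j"
    "\<forall>i<m. \<forall>x<n. \<xi> $ (i * n + x) = (\<Sum>j<r. complex_of_real (c j) * (u j i * v j x))"
    using schmidt_decomposition_exists[of m n "\<lambda>i x. \<xi> $ (i * n + x)"] by blast
  have "schmidt_decomposition m n \<xi> r c (\<lambda>j. vec m (u j)) (\<lambda>j. vec n (v j))"
    using * unfolding schmidt_decomposition_iff[OF \<xi>] orthonormal_family_iff
    by (simp add: orthonormal_def ip_def)
  then have ex: "\<exists>s. ?P s" by blast
  have le: "card {i. i < r \<and> c i \<noteq> 0} \<le> card {i. i < r' \<and> c' i \<noteq> 0}"
    if 1: "schmidt_decomposition m n \<xi> r c u v" and 2: "schmidt_decomposition m n \<xi> r' c' u' v'"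
    for r c u v r' c' u' v'
  proof -
    have "card {i. i < r \<and> complex_of_real (c i) \<noteq> 0} \<le> card {i. i < r' \<and> complex_of_real (c' i) \<noteq> 0}"
    proof (rule schmidt_coefficients_card_le)
      show "orthonormal m r (\<lambda>j i. u j $ i)" "orthonormal n r (\<lambda>j x. v j $ x)" "orthonormal m r' (\<lambda>j i. u' j $ i)"
        using 1 2 by (simp_all add: schmidt_decomposition_def orthonormal_family_iff)
      fix i x assume ix: "i < m" "x < n"
      have "\<xi> $ (i * n + x) = (\<Sum>j<r. complex_of_real (c j) * (u j $ i * v j $ x))"
        using 1 ix unfolding schmidt_decomposition_iff[OF \<xi>] by blast
      moreover have "\<xi> $ (i * n + x) = (\<Sum>j<r'. complex_of_real (c' j) * (u' j $ i * v' j $ x))"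
        using 2 ix unfolding schmidt_decomposition_iff[OF \<xi>] by blast
      ultimately show "(\<Sum>j<r. complex_of_real (c j) * (u j $ i * v j $ x))
          = (\<Sum>j<r'. complex_of_real (c' j) * (u' j $ i * v' j $ x))" by simp
    qed
    then show ?thesis by simp
  qed
  have "?P (THE s. ?P s)"
  proof (rule theI')
    show "\<exists>!s. ?P s"
    proof (rule ex_ex1I[OF ex])
      fix s t assume "?P s" "?P t"
      then obtain r c u v r' c' u' v' where
        "schmidt_decomposition m n \<xi> r c u v" "s = card {i. i < r \<and> c i \<noteq> 0}"
        "schmidt_decomposition m n \<xi> r' c' u' v'" "t = card {i. i < r' \<and> c' i \<noteq> 0}"
        by blast
      then show "s = t" using le[of r c u v r' c' u' v'] le[of r' c' u' v' r c u v] by simp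
    qed
  qed
  then show ?thesis unfolding schmidt_rank_def .
qed

lemma schmidt_le_schmidt_rank:
  assumes \<xi>: "\<xi> \<in> carrier_vec (m * n)"
  shows "schmidt_le m n (schmidt_rank m n \<xi>) (\<lambda>i x. \<xi> $ (i * n + x))"
proof -
  obtain r c u v where dec: "schmidt_decomposition m n \<xi> r c u v"
    and rank: "schmidt_rank m n \<xi> = card {i. i < r \<and> c i \<noteq> 0}"
    using schmidt_rank_attained[OF \<xi>] by blast
  define S where "S = {i. i < r \<and> c i \<noteq> 0}"
  have "finite S" by (simp add: S_def)
  then obtain b where b: "bij_betw b {..<card S} S"
    using ex_bij_betw_nat_finite by (metis lessThan_atLeast0)
  show ?thesis unfolding rank S_def[symmetric]
  proof (rule schmidt_leI)
    fix i x assume "i < m" "x < n"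
    then have "\<xi> $ (i * n + x) = (\<Sum>j<r. complex_of_real (c j) * (u j $ i * v j $ x))"
      using dec unfolding schmidt_decomposition_iff[OF \<xi>] by blast
    also have "\<dots> = (\<Sum>j\<in>S. complex_of_real (c j) * (u j $ i * v j $ x))"
      by (rule sum.mono_neutral_right) (auto simp: S_def)
    also have "\<dots> = (\<Sum>j<card S. complex_of_real (c (b j)) * (u (b j) $ i * v (b j) $ x))"
      by (rule sum.reindex_bij_betw[OF b, symmetric])
    finally show "\<xi> $ (i * n + x) = (\<Sum>j<card S. (complex_of_real (c (b j)) * u (b j) $ i) * v (b j) $ x)"
      by (simp add: mult.assoc)
  qed
qed

section \<open>Schmidt numbers under composition\<close>

text \<open>
  The Choi matrix of a completely positive map is positive, so it has a decomposition into
  rank-one terms and the minimum defining its Schmidt number is attained. Each vector of a minimal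
  decomposition is a sum of as many product vectors as its Schmidt rank.
\<close>

lemma sn_le_map_schmidt_number:
  assumes cp: "completely_positive d \<Phi>" and lin: "mat_linear d \<Phi>" and "0 < d"
  shows "1 \<le> map_schmidt_number d \<Phi>" "sn_le d d (map_schmidt_number d \<Phi>) (choi_coeff d \<Phi>)"
proof -
  let ?P = "\<lambda>s. \<exists>(r::nat) \<xi>. (\<forall>i<r. \<xi> i \<in> carrier_vec (d * d)) \<and>
        choi d \<Phi> = mat_finsum (d * d) (\<lambda>i. ketbra (\<xi> i)) {..<r} \<and>
        s = Max (insert 1 ((\<lambda>i. schmidt_rank d d (\<xi> i)) ` {..<r}))"
  have C: "psd (d * d) (choi d \<Phi>)" by (rule choi_psd[OF cp \<open>0 < d\<close>])
  obtain gs where gs: "\<And>a b. a < d * d \<Longrightarrow> b < d * d \<Longrightarrow> choi d \<Phi> $$ (a, b) = gram gs a b"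
    using psd_gram[OF C] by blast
  define \<xi> where "\<xi> i = vec (d * d) (gs ! i)" for i
  have kc: "ketbra (\<xi> i) \<in> carrier_mat (d * d) (d * d)" for i by (simp add: ketbra_def \<xi>_def)
  have fc: "mat_finsum (d * d) (\<lambda>i. ketbra (\<xi> i)) {..<length gs} \<in> carrier_mat (d * d) (d * d)"
    using kc by (intro mat_finsum_carrier) auto
  have "choi d \<Phi> = mat_finsum (d * d) (\<lambda>i. ketbra (\<xi> i)) {..<length gs}"
  proof (rule eq_matI)
    fix a b assume "a < dim_row (mat_finsum (d * d) (\<lambda>i. ketbra (\<xi> i)) {..<length gs})"
      "b < dim_col (mat_finsum (d * d) (\<lambda>i. ketbra (\<xi> i)) {..<length gs})"
    then have ab: "a < d * d" "b < d * d" using fc by auto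
    have "mat_finsum (d * d) (\<lambda>i. ketbra (\<xi> i)) {..<length gs} $$ (a, b) = (\<Sum>i<length gs. ketbra (\<xi> i) $$ (a, b))"
      using kc ab by (intro mat_finsum_index) auto
    also have "\<dots> = gram gs a b"
      using ab by (simp add: gram_def sum_list_sum_nth lessThan_atLeast0 ketbra_def \<xi>_def)
    finally show "choi d \<Phi> $$ (a, b) = mat_finsum (d * d) (\<lambda>i. ketbra (\<xi> i)) {..<length gs} $$ (a, b)"
      using gs[OF ab] by simp
  qed (use fc C in \<open>auto simp: psd_def\<close>)
  moreover have "\<forall>i<length gs. \<xi> i \<in> carrier_vec (d * d)" by (simp add: \<xi>_def)
  ultimately have "\<exists>s. ?P s" by blast
  then have "?P (map_schmidt_number d \<Phi>)"
    unfolding map_schmidt_number_def schmidt_number_def by (rule LeastI_ex)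
  then obtain r :: nat and \<xi> where \<xi>: "\<And>i. i < r \<Longrightarrow> \<xi> i \<in> carrier_vec (d * d)"
    and choi: "choi d \<Phi> = mat_finsum (d * d) (\<lambda>i. ketbra (\<xi> i)) {..<r}"
    and max: "map_schmidt_number d \<Phi> = Max (insert 1 ((\<lambda>i. schmidt_rank d d (\<xi> i)) ` {..<r}))" by blast
  show "1 \<le> map_schmidt_number d \<Phi>" unfolding max by (intro Max_ge) auto
  have rank: "schmidt_rank d d (\<xi> i) \<le> map_schmidt_number d \<Phi>" if "i < r" for i
    unfolding max using that by (intro Max_ge) auto
  show "sn_le d d (map_schmidt_number d \<Phi>) (choi_coeff d \<Phi>)"
  proof (rule sn_leI[of "map (\<lambda>i p x. \<xi> i $ (p * d + x)) [0..<r]"])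
    fix g assume "g \<in> set (map (\<lambda>i p x. \<xi> i $ (p * d + x)) [0..<r])"
    then obtain i where "i < r" "g = (\<lambda>p x. \<xi> i $ (p * d + x))" by auto
    then show "schmidt_le d d (map_schmidt_number d \<Phi>) g"
      using schmidt_le_mono[OF schmidt_le_schmidt_rank[OF \<xi>] rank] by simp
  next
    fix p x q y assume *: "p < d" "x < d" "q < d" "y < d"
    have "choi_coeff d \<Phi> p x q y = mat_finsum (d * d) (\<lambda>i. ketbra (\<xi> i)) {..<r} $$ (p * d + x, q * d + y)"
      unfolding entries_choi[OF lin *, symmetric] entries_def choi ..
    also have "\<dots> = (\<Sum>i<r. ketbra (\<xi> i) $$ (p * d + x, q * d + y))"
      using \<xi> pair_index(1) * by (intro mat_finsum_index) (auto simp: ketbra_def)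
    also have "\<dots> = (\<Sum>i<r. \<xi> i $ (p * d + x) * cnj (\<xi> i $ (q * d + y)))"
    proof (intro sum.cong refl)
      fix i assume "i \<in> {..<r}"
      then have "dim_vec (\<xi> i) = d * d" using \<xi> by auto
      then show "ketbra (\<xi> i) $$ (p * d + x, q * d + y) = \<xi> i $ (p * d + x) * cnj (\<xi> i $ (q * d + y))"
        using pair_index(1)[OF *(1,2)] pair_index(1)[OF *(3,4)] by (simp add: ketbra_def)
    qed
    finally show "choi_coeff d \<Phi> p x q y
        = (\<Sum>g\<leftarrow>map (\<lambda>i p x. \<xi> i $ (p * d + x)) [0..<r]. g p x * cnj (g q y))"
      by (simp add: comp_def interv_sum_list_conv_sum_set_nat lessThan_atLeast0)
  qed
qed

lemma sn_le_id_tensor_decrease: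
  assumes eb: "k_entanglement_breaking k d \<Phi>"
    and J: "sn_le d d t (choi_coeff d \<Phi>)" and X: "sn_le n d s (entries d X)"
  shows "sn_le n d (Suc (s - k)) (entries d (id_tensor n d \<Phi> X))"
proof -
  have lin: "mat_linear d \<Phi>" using eb by (simp add: k_entanglement_breaking_def k_positive_def)
  show ?thesis
    by (rule sn_le_cong[OF sn_le_choi_apply_decrease[OF k_entanglement_breaking_pure[OF eb] J X]])
      (rule entries_id_tensor[OF lin])
qed

text \<open>
  Since \<open>Suc (s - k)\<close> is \<open>max 1 (s - (k - 1))\<close>, iterating the central step subtracts \<open>k - 1\<close> each time
  until the bound is 1. Starting from an arbitrary power \<open>j\<close> allows a different bound for the first
  application.
\<close>

lemma sn_le_id_tensor_funpow:
  assumes eb: "k_entanglement_breaking k d \<Phi>" and "0 < k"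
    and J: "sn_le d d t (choi_coeff d \<Phi>)" and X: "sn_le n d s (entries d (id_tensor n d (\<Phi> ^^ j) X))"
  shows "sn_le n d (max 1 (s - i * (k - 1))) (entries d (id_tensor n d (\<Phi> ^^ (i + j)) X))"
proof (induction i)
  case 0
  show ?case using X by (auto intro: sn_le_mono)
next
  case (Suc i)
  have lin: "mat_linear d \<Phi>" using eb by (simp add: k_entanglement_breaking_def k_positive_def)
  have "id_tensor n d (\<Phi> ^^ (Suc i + j)) X = id_tensor n d \<Phi> (id_tensor n d (\<Phi> ^^ (i + j)) X)"
    using id_tensor_comp[OF lin mat_linear_funpow[OF lin], of n "i + j" X] by simp
  then have "sn_le n d (Suc (max 1 (s - i * (k - 1)) - k)) (entries d (id_tensor n d (\<Phi> ^^ (Suc i + j)) X))"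
    using sn_le_id_tensor_decrease[OF eb J Suc] by simp
  moreover have "Suc (max 1 (s - i * (k - 1)) - k) \<le> max 1 (s - Suc i * (k - 1))"
  proof -
    obtain k' where "k = Suc k'" using \<open>0 < k\<close> by (cases k) auto
    then show ?thesis by simp
  qed
  ultimately show ?case by (rule sn_le_mono)
qed

theorem corollary5p9:
  fixes k d m :: nat and \<Phi> :: "complex mat \<Rightarrow> complex mat"
  assumes "2 \<le> k" and "k \<le> d"
    and "completely_positive d \<Phi>"
    and "k_entanglement_breaking k d \<Phi>"
    and "m = min (map_schmidt_number d \<Phi>) (nat \<lceil>(real d - 1) / (real k - 1)\<rceil>)"
  shows "entanglement_breaking d (\<Phi> ^^ m)"
proof -
  have lin: "mat_linear d \<Phi>"
    using assms(4) by (simp add: k_entanglement_breaking_def k_positive_def)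
  define s where "s = map_schmidt_number d \<Phi>"
  have "1 \<le> s" and J: "sn_le d d s (choi_coeff d \<Phi>)"
    using sn_le_map_schmidt_number[OF assms(3) lin] assms(1,2) by (auto simp: s_def)
  have "separable n d (id_tensor n d (\<Phi> ^^ m) X)" if X: "psd (n * d) X" for n X
  proof (rule sn_le_imp_separable)
    show "id_tensor n d (\<Phi> ^^ m) X \<in> carrier_mat (n * d) (n * d)"
      by (rule id_tensor_carrier[OF mat_linear_funpow[OF lin]])
    have step: "sn_le n d 1 (entries d (id_tensor n d (\<Phi> ^^ (i + j)) X))"
      if "sn_le n d t (entries d (id_tensor n d (\<Phi> ^^ j) X))" "t - i * (k - 1) \<le> 1" for i j t
      using sn_le_id_tensor_funpow[OF assms(4) _ J that(1), of i] that(2) assms(1) by (simp add: max_absorb1)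
    \<comment> \<open>Whichever of the two numbers is the minimum, its own count of applications suffices.\<close>
    consider "m = s" | "m = nat \<lceil>(real d - 1) / (real k - 1)\<rceil>" using assms(5) unfolding s_def by linarith
    then show "sn_le n d 1 (entries d (id_tensor n d (\<Phi> ^^ m) X))"
    proof cases
      case 1
      have "sn_le n d s (entries d (id_tensor n d \<Phi> X))"
        by (rule sn_le_cong[OF sn_le_choi_apply[OF J psd_imp_sn_le[OF X]]]) (rule entries_id_tensor[OF lin])
      moreover have "s - (s - 1) * (k - 1) \<le> 1"
      proof -
        \<comment> \<open>After the first application \<open>s - 1\<close> remain, each lowering the bound by at least 1.\<close>
        have "(s - 1) * 1 \<le> (s - 1) * (k - 1)" using assms(1) by (intro mult_le_mono2) simp
        then have "s - (s - 1) * (k - 1) \<le> s - (s - 1) * 1" by (rule diff_le_mono2)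
        then show ?thesis by simp
      qed
      ultimately have "sn_le n d 1 (entries d (id_tensor n d (\<Phi> ^^ (s - 1 + 1)) X))"
        by (intro step[of s 1 "s - 1"]) simp_all
      then show ?thesis using 1 \<open>1 \<le> s\<close> by simp
    next
      case 2
      have "id_tensor n d id X = X"
      proof (rule eq_matI)
        fix a b assume "a < dim_row X" "b < dim_col X"
        then have ab: "a < n * d" "b < n * d" using X by (auto simp: psd_def)
        then have "a mod d < d" "b mod d < d" by (auto intro!: mod_less_divisor gr0I)
        then show "id_tensor n d id X $$ (a, b) = X $$ (a, b)"
          by (simp add: id_tensor_index[OF mat_linear_id[OF lin] ab] mat_block_def)
      qed (use X in \<open>auto simp: psd_def carrier_matD[OF id_tensor_carrier[OF mat_linear_id[OF lin]]]\<close>)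
      then have "sn_le n d d (entries d (id_tensor n d (\<Phi> ^^ 0) X))"
        using psd_imp_sn_le[OF X] by (simp add: id_def)
      moreover have "d - m * (k - 1) \<le> 1"
      proof -
        have "(real d - 1) / (real k - 1) \<le> real m" unfolding 2 by linarith
        then have "real d - 1 \<le> real m * (real k - 1)" using assms(1) by (simp add: divide_le_eq)
        also have "\<dots> = real (m * (k - 1))" using assms(1) by (simp add: of_nat_diff)
        finally show ?thesis by linarith
      qed
      ultimately show ?thesis using step[of d 0 m] by simp
    qed
  qed
  then show ?thesis
    unfolding entanglement_breaking_def using mat_linear_funpow[OF lin] by blast
qed

end
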